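(* Let $d\ge 2$, let $\mathcal A\in\mathbb C^{n_1\times n_2\times\cdots\times n_d}$ be any tensor and let $\mathbf r=(1,r_1,\dots,r_{d-1},1)$ be any rank parameter (with $\mathcal N_{\mathbf r}\neq\emptyset$). Let $\mathrm P_{\mathcal N_{\mathbf r}}(\mathcal A)$ denote a best approximation of $\mathcal A$ in $\mathcal N_{\mathbf r}$, i.e. a minimizer of $\|\mathcal X-\mathcal A\|_{\mathrm F}$ over $\mathcal X\in\mathcal N_{\mathbf r}$ (assumed to exist), and let $\mathrm P^{\mathrm{NTTSVD}}_{\mathbf r}(\mathcal A)$ be the output of the NTT-SVD algorithm. Then $$\|\mathrm P_{\mathcal N_{\mathbf r}}(\mathcal A)-\mathcal A\|_{\mathrm F}\ \le\ \|\mathrm P^{\mathrm{NTTSVD}}_{\mathbf r}(\mathcal A)-\mathcal A\|_{\mathrm F}\ \le\ (2\sqrt{d-1}+1)\,\|\mathrm P_{\mathcal N_{\mathbf r}}(\mathcal A)-\mathcal A\|_{\mathrm F}.$$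
   Context: Unfoldings and TT rank: for $\mathcal X\in\mathbb C^{n_1\times\cdots\times n_d}$ and $k\in\{1,\dots,d-1\}$, the $k$-th unfolding $\mathbf X_{\langle k\rangle}\in\mathbb C^{(n_1\cdots n_k)\times(n_{k+1}\cdots n_d)}$ has rows indexed by $(i_1,\dots,i_k)$ and columns by $(i_{k+1},\dots,i_d)$ (in each group the first index varies fastest). $\mathrm{rank}_{\mathrm{TT}}(\mathcal X)=(1,\mathrm{rank}\,\mathbf X_{\langle1\rangle},\dots,\mathrm{rank}\,\mathbf X_{\langle d-1\rangle},1)$. $\|\cdot\|_{\mathrm F}$ is the Frobenius norm (root of the sum of squared moduli of entries). $\mathcal N_{\mathbf r}=\{\mathcal X\in\mathbb C^{n_1\times\cdots\times n_d}:\mathrm{rank}_{\mathrm{TT}}(\mathcal X)=\mathbf r,\ \|\mathcal X\|_{\mathrm F}=1\}$, and $\mathcal B_1=\{\mathcal X:\|\mathcal X\|_{\mathrm F}=1\}$. TT format: for cores $\mathcal U_k\in\mathbb C^{r_{k-1}\times n_k\times r_k}$ ($r_0=r_d=1$), $[\![\mathcal U_1,\dots,\mathcal U_d]\!]$ is the tensor with entries $\mathbf U_1(i_1)\mathbf U_2(i_2)\cdots\mathbf U_d(i_d)$, where $\mathbf U_k(i_k)=\mathcal U_k(:,i_k,:)$. TT-SVD algorithm $\mathrm P^{\mathrm{TTSVD}}_{\mathbf r}$: set $\mathbf T_0=\mathcal A$. For $k=1,\dots,d-1$: reshape $\mathbf T_{k-1}$ into a matrix of size $(r_{k-1}n_k)\times(n_{k+1}\cdots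 n_d)$; take a singular value decomposition truncated to the $r_k$ leading singular triplets, $\mathbf U_k\mathbf S_k\mathbf V_k^\dagger$; reshape $\mathbf U_k$ into the core $\mathcal U_k\in\mathbb C^{r_{k-1}\times n_k\times r_k}$; set $\mathbf T_k=\mathbf S_k\mathbf V_k^\dagger$. Finally $\mathcal U_d$ is $\mathbf T_{d-1}$ reshaped to $r_{d-1}\times n_d\times 1$, and $\mathrm P^{\mathrm{TTSVD}}_{\mathbf r}(\mathcal A)=[\![\mathcal U_1,\dots,\mathcal U_d]\!]$. NTT-SVD algorithm: $\mathrm P^{\mathrm{NTTSVD}}_{\mathbf r}(\mathcal A)=\mathrm P_{\mathcal B_1}(\mathrm P^{\mathrm{TTSVD}}_{\mathbf r}(\mathcal A))$, where $\mathrm P_{\mathcal B_1}$ is the metric projection onto the unit sphere, i.e. $\mathrm P_{\mathcal B_1}(\mathcal Y)=\mathcal Y/\|\mathcal Y\|_{\mathrm F}$ for $\mathcal Y\ne0$ (and an arbitrary element of $\mathcal B_1$ if $\mathcal Y=0$). *)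

theory Defs
  imports
    Complex_Main
    "Jordan_Normal_Form.DL_Rank"
    "Jordan_Normal_Form.Schur_Decomposition"
begin

text \<open>
  A complex tensor of shape \<open>ns = [n\<^sub>1, \<dots>, n\<^sub>d]\<close> is a function on multi-indices (lists of length \<open>d\<close>),
  normalised to be 0 outside the index set, so that equality of tensors is equality of functions.
  All indices count from 0. In a list, \<open>n\<^sub>k\<close> is \<open>ns ! (k - 1)\<close>; a rank parameter is the full list
  \<open>rs = [r\<^sub>0, r\<^sub>1, \<dots>, r\<^sub>d]\<close>, so \<open>r\<^sub>k\<close> is \<open>rs ! k\<close>.
\<close>

type_synonym tensor = "nat list \<Rightarrow> complex"

definition indices :: "nat list \<Rightarrow> nat list set" where
  "indices ns = {ix. length ix = length ns \<and> (\<forall>k < length ns. ix ! k < ns ! k)}"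

definition tensors :: "nat list \<Rightarrow> tensor set" where
  "tensors ns = {X. \<forall>ix. ix \<notin> indices ns \<longrightarrow> X ix = 0}"

definition fnorm :: "nat list \<Rightarrow> tensor \<Rightarrow> real" where
  "fnorm ns X = sqrt (\<Sum>ix \<in> indices ns. (cmod (X ix))\<^sup>2)"

text \<open>The multi-index at a given linear position, first index varying fastest.\<close>

fun multi_index :: "nat list \<Rightarrow> nat \<Rightarrow> nat list" where
  "multi_index [] p = []"
| "multi_index (n # ns) p = (p mod n) # multi_index ns (p div n)"

text \<open>For \<open>k = 0\<close> this is the tensor written as a single row.\<close>

definition unfolding_mat :: "nat list \<Rightarrow> nat \<Rightarrow> tensor \<Rightarrow> complex mat" where
  "unfolding_mat ns k X =
     mat (prod_list (take k ns)) (prod_list (drop k ns))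
       (\<lambda>(p, q). X (multi_index (take k ns) p @ multi_index (drop k ns) q))"

definition mat_rank :: "complex mat \<Rightarrow> nat" where
  "mat_rank M = vec_space.rank (dim_row M) M"

definition tt_rank :: "nat list \<Rightarrow> tensor \<Rightarrow> nat list" where
  "tt_rank ns X = 1 # map (\<lambda>k. mat_rank (unfolding_mat ns k X)) [1..<length ns] @ [1]"

definition unit_sphere :: "nat list \<Rightarrow> tensor set" where
  "unit_sphere ns = {X \<in> tensors ns. fnorm ns X = 1}"

definition normalized_tt :: "nat list \<Rightarrow> nat list \<Rightarrow> tensor set" where
  "normalized_tt ns rs = {X \<in> tensors ns. tt_rank ns X = rs \<and> fnorm ns X = 1}"

definition best_approximation :: "nat list \<Rightarrow> tensor set \<Rightarrow> tensor \<Rightarrow> tensor \<Rightarrow> bool" where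
  "best_approximation ns S A P \<longleftrightarrow>
     P \<in> S \<and> (\<forall>X \<in> S. fnorm ns (P - A) \<le> fnorm ns (X - A))"

definition core_slice :: "nat \<Rightarrow> nat \<Rightarrow> tensor \<Rightarrow> nat \<Rightarrow> complex mat" where
  "core_slice r r' C i = mat r r' (\<lambda>(a, b). C [a, i, b])"

text \<open>The product of slices is a \<open>1 \<times> 1\<close> matrix when \<open>r\<^sub>0 = r\<^sub>d = 1\<close>.\<close>

definition tt_tensor :: "nat list \<Rightarrow> nat list \<Rightarrow> (nat \<Rightarrow> tensor) \<Rightarrow> tensor" where
  "tt_tensor ns rs C = (\<lambda>ix.
     if ix \<in> indices ns
     then foldr (*)
            (map (\<lambda>k. core_slice (rs ! (k - 1)) (rs ! k) (C k) (ix ! (k - 1))) [1..<Suc (length ns)])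
            (1\<^sub>m 1) $$ (0, 0)
     else 0)"

text \<open>Reshaping keeps the column-major (first index fastest) linear position of every entry.\<close>

definition reshape :: "nat \<Rightarrow> nat \<Rightarrow> complex mat \<Rightarrow> complex mat" where
  "reshape m n M =
     mat m n (\<lambda>(i, j). M $$ ((i + m * j) mod dim_row M, (i + m * j) div dim_row M))"

definition mat_to_core :: "nat \<Rightarrow> nat \<Rightarrow> nat \<Rightarrow> complex mat \<Rightarrow> tensor" where
  "mat_to_core r n r' M = (\<lambda>ix.
     if ix \<in> indices [r, n, r'] then M $$ (ix ! 0 + r * (ix ! 1), ix ! 2) else 0)"

definition unitary_mat :: "nat \<Rightarrow> complex mat \<Rightarrow> bool" where
  "unitary_mat n U \<longleftrightarrow> U \<in> carrier_mat n n \<and> mat_adjoint U * U = 1\<^sub>m n"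

definition is_svd :: "complex mat \<Rightarrow> complex mat \<Rightarrow> (nat \<Rightarrow> real) \<Rightarrow> complex mat \<Rightarrow> bool" where
  "is_svd M U \<sigma> V \<longleftrightarrow>
     unitary_mat (dim_row M) U \<and> unitary_mat (dim_col M) V \<and>
     (\<forall>i < min (dim_row M) (dim_col M). 0 \<le> \<sigma> i) \<and>
     (\<forall>i j. i \<le> j \<longrightarrow> j < min (dim_row M) (dim_col M) \<longrightarrow> \<sigma> j \<le> \<sigma> i) \<and>
     M = U * mat (dim_row M) (dim_col M) (\<lambda>(i, j). if i = j then complex_of_real (\<sigma> i) else 0)
           * mat_adjoint V"

text \<open>
  A relation, because neither the singular vectors nor, for repeated singular values, the leading
  subspaces are unique. The \<open>r\<close> leading triplets exist only if \<open>r\<close> is at most both dimensions.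
\<close>

definition truncated_svd ::
    "nat \<Rightarrow> complex mat \<Rightarrow> complex mat \<Rightarrow> complex mat \<Rightarrow> complex mat \<Rightarrow> bool" where
  "truncated_svd r M U\<^sub>r S\<^sub>r V\<^sub>r \<longleftrightarrow>
     r \<le> min (dim_row M) (dim_col M) \<and>
     (\<exists>U \<sigma> V. is_svd M U \<sigma> V \<and>
        U\<^sub>r = mat (dim_row M) r (\<lambda>(i, j). U $$ (i, j)) \<and>
        S\<^sub>r = mat r r (\<lambda>(i, j). if i = j then complex_of_real (\<sigma> i) else 0) \<and>
        V\<^sub>r = mat (dim_col M) r (\<lambda>(i, j). V $$ (i, j)))"

text \<open>
  \<open>Y\<close> is the result of some run of the algorithm, for some choice of the singular value
  decompositions; \<open>T\<close> and \<open>C\<close> collect the intermediate matrices and the cores.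
\<close>

definition ttsvd_output :: "nat list \<Rightarrow> nat list \<Rightarrow> tensor \<Rightarrow> tensor \<Rightarrow> bool" where
  "ttsvd_output ns rs A Y \<longleftrightarrow>
     (\<exists>T C.
        T 0 = unfolding_mat ns 0 A \<and>
        (\<forall>k \<in> {1..<length ns}. \<exists>U S V.
           truncated_svd (rs ! k)
             (reshape (rs ! (k - 1) * ns ! (k - 1)) (prod_list (drop k ns)) (T (k - 1))) U S V \<and>
           C k = mat_to_core (rs ! (k - 1)) (ns ! (k - 1)) (rs ! k) U \<and>
           T k = S * mat_adjoint V) \<and>
        C (length ns) =
          (let r = rs ! (length ns - 1); n = ns ! (length ns - 1)
           in mat_to_core r n 1 (reshape (r * n) 1 (T (length ns - 1)))) \<and>
        Y = tt_tensor ns rs C)"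

definition sphere_projection :: "nat list \<Rightarrow> tensor \<Rightarrow> tensor \<Rightarrow> bool" where
  "sphere_projection ns Y Q \<longleftrightarrow>
     (if Y = (\<lambda>_. 0) then Q \<in> unit_sphere ns
      else Q = (\<lambda>ix. Y ix / complex_of_real (fnorm ns Y)))"

definition nttsvd_output :: "nat list \<Rightarrow> nat list \<Rightarrow> tensor \<Rightarrow> tensor \<Rightarrow> bool" where
  "nttsvd_output ns rs A Q \<longleftrightarrow> (\<exists>Y. ttsvd_output ns rs A Y \<and> sphere_projection ns Y Q)"

end

theory Submission
  imports Defs "HOL-Analysis.L2_Norm"
begin

text \<open>
  Write \<open>r\<close> for the rank parameter, \<open>Y\<close> for the TT-SVD output, \<open>Q\<close> for its normalization and
  \<open>P\<close> for a best approximation.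

  The upper bound rests on the quasi-optimality of TT-SVD,
  \<open>\<parallel>Y - A\<parallel> \<le> sqrt (d - 1) \<cdot> \<parallel>X - A\<parallel>\<close> for every \<open>X\<close> whose unfoldings have ranks at most \<open>r\<^sub>k\<close>
  (\<open>ttsvd_quasi_optimal\<close>). Contracting the first \<open>k\<close> computed cores gives an orthonormal family of
  tensors \<open>W\<^sub>k\<close> on the first \<open>k\<close> modes, and the intermediate matrix is \<open>T\<^sub>k = W\<^sub>k\<^sup>* A\<close>, where \<open>A\<close> is
  unfolded at \<open>k\<close>. The output is therefore the orthogonal projection of \<open>A\<close> onto the span of
  \<open>W\<close> at stage \<open>d - 1\<close>, and the squared error is the total loss of energy
  \<open>\<parallel>T\<^sub>0\<parallel>\<^sup>2 - \<parallel>T\<^sub>d\<^sub>-\<^sub>1\<parallel>\<^sup>2\<close>. One step loses \<open>\<parallel>T\<^sub>k\<parallel>\<^sup>2 - \<parallel>T\<^sub>k\<^sub>+\<^sub>1\<parallel>\<^sup>2\<close>, the squared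
  error of the truncated SVD of the reshaped \<open>T\<^sub>k\<close>. By the Eckart-Young inequality
  (\<open>truncated_svd_optimal\<close>) this is at most the squared distance to any matrix of rank at most
  \<open>r\<^sub>k\<^sub>+\<^sub>1\<close>; taking for it the contraction of \<open>X\<close> with \<open>W\<^sub>k\<close> and using that this contraction does
  not increase norms, the loss is at most \<open>\<parallel>X - A\<parallel>\<^sup>2\<close> (\<open>energy_drop_le\<close>). Sum over the \<open>d - 1\<close> steps.

  If \<open>Y \<noteq> 0\<close>, then \<open>\<parallel>Q - Y\<parallel> = \<bar>1 - \<parallel>Y\<parallel>\<bar> \<le> \<parallel>P - Y\<parallel> \<le> \<parallel>P - A\<parallel> + \<parallel>Y - A\<parallel>\<close> because
  \<open>\<parallel>P\<parallel> = 1\<close>, and the triangle inequality gives the factor \<open>2 sqrt (d - 1) + 1\<close>. If \<open>Y = 0\<close>, then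
  \<open>A = 0\<close> (\<open>ttsvd_zero_imp_zero\<close>) and all unit tensors are at distance 1 from \<open>A\<close>.

  The lower bound is not immediate from the minimality of \<open>P\<close>, since the ranks of \<open>Q\<close> may be strictly
  smaller than \<open>r\<close>. But \<open>Q\<close> lies in the closure of the tensors of rank \<open>r\<close> and norm 1: move the
  cores of \<open>Y\<close> along a straight line towards cores of \<open>P\<close>. The ranks on this line never exceed
  \<open>r\<close>, and they equal \<open>r\<close> wherever certain determinants do not vanish; these determinants are
  polynomials in the line parameter that are nonzero at \<open>P\<close>, so they have finitely many zeros. Hence
  tensors of rank \<open>r\<close> occur arbitrarily close to \<open>Y\<close>, and after normalization the minimality of \<open>P\<close>
  passes to the limit \<open>Q\<close> (\<open>best_approximation_le_normalized_tt\<close>).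
\<close>

section \<open>Orthogonal families and Bessel's inequality\<close>

definition inner_on :: "'i set \<Rightarrow> ('i \<Rightarrow> complex) \<Rightarrow> ('i \<Rightarrow> complex) \<Rightarrow> complex" where
  "inner_on I u v = (\<Sum>i\<in>I. cnj (u i) * v i)"

definition sqnorm_on :: "'i set \<Rightarrow> ('i \<Rightarrow> complex) \<Rightarrow> real" where
  "sqnorm_on I v = (\<Sum>i\<in>I. (cmod (v i))\<^sup>2)"

text \<open>
  Vectors of norm 0 are allowed so that the Gram-Schmidt process produces exactly as many vectors as
  it is given; a zero vector contributes nothing to projections.
\<close>

definition orthogonal_family :: "'i set \<Rightarrow> nat \<Rightarrow> (nat \<Rightarrow> 'i \<Rightarrow> complex) \<Rightarrow> bool" where
  "orthogonal_family I r e \<longleftrightarrow>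
     (\<forall>a<r. \<forall>b<r. a \<noteq> b \<longrightarrow> inner_on I (e a) (e b) = 0) \<and>
     (\<forall>a<r. sqnorm_on I (e a) = 0 \<or> sqnorm_on I (e a) = 1)"

lemma inner_on_self: "inner_on I v v = of_real (sqnorm_on I v)"
  unfolding inner_on_def sqnorm_on_def of_real_sum
  by (intro sum.cong refl) (metis complex_norm_square mult.commute of_real_power)

lemma sqnorm_on_nonneg: "0 \<le> sqnorm_on I v"
  unfolding sqnorm_on_def by (intro sum_nonneg) auto

lemma inner_on_commute: "inner_on I u v = cnj (inner_on I v u)"
  unfolding inner_on_def by (simp add: mult.commute)

lemma inner_on_diff_right: "inner_on I u (\<lambda>i. v i - w i) = inner_on I u v - inner_on I u w"
  unfolding inner_on_def by (simp add: algebra_simps sum_subtractf)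

lemma inner_on_sum_right:
  "inner_on I u (\<lambda>i. \<Sum>b\<in>B. c b * w b i) = (\<Sum>b\<in>B. c b * inner_on I u (w b))"
  unfolding inner_on_def sum_distrib_left
  by (subst sum.swap) (simp add: algebra_simps)

lemma inner_on_diff_left: "inner_on I (\<lambda>i. v i - w i) u = inner_on I v u - inner_on I w u"
  unfolding inner_on_def by (simp add: algebra_simps sum_subtractf)

lemma inner_on_sum_left:
  "inner_on I (\<lambda>i. \<Sum>b\<in>B. c b * w b i) u = (\<Sum>b\<in>B. cnj (c b) * inner_on I (w b) u)"
  by (subst inner_on_commute, simp add: inner_on_sum_right cnj_sum, subst (2) inner_on_commute, simp)

lemma sqnorm_on_zero_iff: "finite I \<Longrightarrow> sqnorm_on I v = 0 \<longleftrightarrow> (\<forall>i\<in>I. v i = 0)"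
  unfolding sqnorm_on_def by (subst sum_nonneg_eq_0_iff) auto

lemma inner_on_cong:
  "(\<And>i. i \<in> I \<Longrightarrow> u i = u' i) \<Longrightarrow> (\<And>i. i \<in> I \<Longrightarrow> v i = v' i) \<Longrightarrow> inner_on I u v = inner_on I u' v'"
  unfolding inner_on_def by (intro sum.cong) auto

lemma sqnorm_on_cong: "(\<And>i. i \<in> I \<Longrightarrow> u i = u' i) \<Longrightarrow> sqnorm_on I u = sqnorm_on I u'"
  unfolding sqnorm_on_def by (intro sum.cong) auto

lemma orthogonal_family_coefficient:
  assumes I: "finite I" and e: "orthogonal_family I r e" and a: "a < r"
  shows "(\<Sum>b<r. c b * inner_on I (e a) (e b)) = c a * of_real (sqnorm_on I (e a))"
proof -
  have "(\<Sum>b<r. c b * inner_on I (e a) (e b)) = (\<Sum>b\<in>{a}. c b * inner_on I (e a) (e b))"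
    using e a unfolding orthogonal_family_def by (intro sum.mono_neutral_right) auto
  then show ?thesis by (simp add: inner_on_self)
qed

lemma orthogonal_family_residual:
  assumes I: "finite I" and e: "orthogonal_family I r e" and a: "a < r"
  shows "inner_on I (e a) (\<lambda>i. x i - (\<Sum>b<r. inner_on I (e b) x * e b i)) = 0"
proof -
  have "inner_on I (e a) x = 0" if "sqnorm_on I (e a) = 0"
    using that by (simp add: sqnorm_on_zero_iff[OF I] inner_on_def)
  then show ?thesis
    using e a unfolding inner_on_diff_right inner_on_sum_right
      orthogonal_family_coefficient[OF I e a] orthogonal_family_def by auto
qed

lemma sqnorm_residual:
  assumes I: "finite I" and e: "orthogonal_family I r e"
  shows "sqnorm_on I (\<lambda>i. x i - (\<Sum>b<r. inner_on I (e b) x * e b i)) =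
         sqnorm_on I x - (\<Sum>b<r. (cmod (inner_on I (e b) x))\<^sup>2)"
proof -
  define res where "res = (\<lambda>i. x i - (\<Sum>b<r. inner_on I (e b) x * e b i))"
  have 0: "inner_on I (e b) res = 0" if "b < r" for b
    unfolding res_def by (rule orthogonal_family_residual[OF I e that])
  have "complex_of_real (sqnorm_on I res) = inner_on I res res"
    by (simp add: inner_on_self)
  also have "\<dots> = inner_on I x res - (\<Sum>b<r. cnj (inner_on I (e b) x) * inner_on I (e b) res)"
    by (subst res_def) (simp add: inner_on_diff_left inner_on_sum_left)
  also have "\<dots> = inner_on I x res" using 0 by simp
  also have "\<dots> = inner_on I x x - (\<Sum>b<r. inner_on I (e b) x * inner_on I x (e b))"
    by (simp add: res_def inner_on_diff_right inner_on_sum_right)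
  also have "(\<Sum>b<r. inner_on I (e b) x * inner_on I x (e b)) =
      (\<Sum>b<r. complex_of_real ((cmod (inner_on I (e b) x))\<^sup>2))"
    by (intro sum.cong refl) (metis complex_norm_square inner_on_commute of_real_power)
  finally have "complex_of_real (sqnorm_on I res) =
      of_real (sqnorm_on I x - (\<Sum>b<r. (cmod (inner_on I (e b) x))\<^sup>2))"
    by (simp add: inner_on_self)
  then show ?thesis unfolding res_def of_real_eq_iff .
qed

lemma bessel_inequality:
  assumes "finite I" and "orthogonal_family I r e"
  shows "(\<Sum>b<r. (cmod (inner_on I (e b) x))\<^sup>2) \<le> sqnorm_on I x"
proof -
  have "0 \<le> sqnorm_on I (\<lambda>i. x i - (\<Sum>b<r. inner_on I (e b) x * e b i))"
    by (rule sqnorm_on_nonneg)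
  then show ?thesis unfolding sqnorm_residual[OF assms] by simp
qed

text \<open>
  The orthogonal projection is the best approximation from the span. Subtracting a combination of the
  family from \<open>x\<close> does not change the residual of \<open>x\<close>, and by Bessel the residual of a vector is no
  longer than the vector.
\<close>

lemma sqnorm_residual_le:
  assumes I: "finite I" and e: "orthogonal_family I r e"
  shows "sqnorm_on I x - (\<Sum>b<r. (cmod (inner_on I (e b) x))\<^sup>2)
         \<le> sqnorm_on I (\<lambda>i. x i - (\<Sum>b<r. c b * e b i))"
proof -
  define y where "y = (\<lambda>i. x i - (\<Sum>b<r. c b * e b i))"
  have ey: "inner_on I (e b) y = inner_on I (e b) x - c b * of_real (sqnorm_on I (e b))"
    if "b < r" for b
    unfolding y_def inner_on_diff_right inner_on_sum_right
    using orthogonal_family_coefficient[OF I e that] by simp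
  have term_eq: "inner_on I (e b) y * e b i = inner_on I (e b) x * e b i - c b * e b i"
    if "b < r" "i \<in> I" for b i
  proof (cases "sqnorm_on I (e b) = 0")
    case True
    then have "e b i = 0" using that by (simp add: sqnorm_on_zero_iff[OF I])
    then show ?thesis by simp
  next
    case False
    then have "sqnorm_on I (e b) = 1" using e that unfolding orthogonal_family_def by blast
    then show ?thesis by (simp add: ey[OF that(1)] algebra_simps)
  qed
  have "y i - (\<Sum>b<r. inner_on I (e b) y * e b i) = x i - (\<Sum>b<r. inner_on I (e b) x * e b i)"
    if "i \<in> I" for i
  proof -
    have "(\<Sum>b<r. inner_on I (e b) y * e b i) =
        (\<Sum>b<r. inner_on I (e b) x * e b i) - (\<Sum>b<r. c b * e b i)"
      using that by (simp add: term_eq sum_subtractf)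
    then show ?thesis unfolding y_def by simp
  qed
  then have "sqnorm_on I y - (\<Sum>b<r. (cmod (inner_on I (e b) y))\<^sup>2) =
      sqnorm_on I x - (\<Sum>b<r. (cmod (inner_on I (e b) x))\<^sup>2)"
    unfolding sqnorm_residual[OF assms, symmetric] by (intro sqnorm_on_cong)
  moreover have "0 \<le> (\<Sum>b<r. (cmod (inner_on I (e b) y))\<^sup>2)" by (intro sum_nonneg) auto
  ultimately show ?thesis unfolding y_def by linarith
qed

lemma gram_schmidt_family:
  assumes I: "finite I"
  shows "\<exists>e K. orthogonal_family I r e \<and> (\<forall>a<r. \<forall>i\<in>I. f a i = (\<Sum>b<r. K a b * e b i))"
proof (induction r)
  case 0
  show ?case by (simp add: orthogonal_family_def)
next
  case (Suc r)
  then obtain e K where e: "orthogonal_family I r e"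
    and K: "\<And>a i. a < r \<Longrightarrow> i \<in> I \<Longrightarrow> f a i = (\<Sum>b<r. K a b * e b i)" by blast
  define res where "res = (\<lambda>i. f r i - (\<Sum>b<r. inner_on I (e b) (f r) * e b i))"
  define s where "s = sqrt (sqnorm_on I res)"
  \<comment> \<open>If \<open>s = 0\<close>, the division by zero makes \<open>g\<close> the zero vector, as intended.\<close>
  define g where "g = (\<lambda>i. res i / complex_of_real s)"
  define e' where "e' = e(r := g)"
  define K' where "K' = (\<lambda>a b. if a = r then (if b = r then complex_of_real s else inner_on I (e b) (f r))
      else if b = r then 0 else K a b)"
  have s2: "s\<^sup>2 = sqnorm_on I res" unfolding s_def by (simp add: sqnorm_on_nonneg)
  have g0: "inner_on I (e a) g = 0" if "a < r" for a
  proof -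
    have "inner_on I (e a) g = inner_on I (e a) res / of_real s"
      unfolding inner_on_def g_def by (simp add: sum_divide_distrib)
    then show ?thesis
      using orthogonal_family_residual[OF I e that] by (simp add: res_def)
  qed
  then have g0': "inner_on I g (e a) = 0" if "a < r" for a
    using that by (subst inner_on_commute) simp
  have "sqnorm_on I g = sqnorm_on I res / s\<^sup>2"
    unfolding sqnorm_on_def g_def by (simp add: norm_divide power_divide sum_divide_distrib)
  then have g1: "sqnorm_on I g = 0 \<or> sqnorm_on I g = 1" using s2 by auto
  have "orthogonal_family I (Suc r) e'"
    using e g0 g0' g1 unfolding orthogonal_family_def e'_def by (auto simp: less_Suc_eq)
  moreover have "f a i = (\<Sum>b<Suc r. K' a b * e' b i)" if "a < Suc r" "i \<in> I" for a i
  proof (cases "a = r")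
    case True
    have "of_real s * g i = res i"
    proof (cases "s = 0")
      case True
      then have "res i = 0" using s2 sqnorm_on_zero_iff[OF I] that by simp
      then show ?thesis by (simp add: True)
    qed (simp add: g_def)
    then show ?thesis by (simp add: True K'_def e'_def res_def)
  next
    case False
    then show ?thesis using that K by (simp add: K'_def e'_def)
  qed
  ultimately show ?case by blast
qed

section \<open>Optimality of the truncated singular value decomposition\<close>

lemma index_mat_adjoint:
  "i < dim_col M \<Longrightarrow> j < dim_row M \<Longrightarrow> mat_adjoint M $$ (i, j) = cnj (M $$ (j, i))"
  unfolding mat_adjoint_def by (simp add: mat_of_rows_def)

lemma dim_mat_adjoint [simp]:
  "dim_row (mat_adjoint M) = dim_col M" "dim_col (mat_adjoint M) = dim_row M"
  unfolding mat_adjoint_def by (auto simp: mat_of_rows_def)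

lemma unitary_mat_columns:
  assumes "unitary_mat n U" "a < n" "b < n"
  shows "(\<Sum>i<n. cnj (U $$ (i, a)) * U $$ (i, b)) = (if a = b then 1 else 0)"
proof -
  have U: "U \<in> carrier_mat n n" and "mat_adjoint U * U = 1\<^sub>m n"
    using assms unfolding unitary_mat_def by auto
  then have "(mat_adjoint U * U) $$ (a, b) = (if a = b then 1 else 0)" using assms by simp
  moreover have "(mat_adjoint U * U) $$ (a, b) = (\<Sum>i<n. cnj (U $$ (i, a)) * U $$ (i, b))"
    using U assms
    by (auto simp: scalar_prod_def index_mat_adjoint atLeast0LessThan intro!: sum.cong)
  ultimately show ?thesis by simp
qed

text \<open>
  Coordinates eliminate the rectangular diagonal factor: \<open>M\<close> becomes the sum of \<open>\<sigma>\<^sub>b u\<^sub>b v\<^sub>b\<^sup>*\<close> over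
  the singular triplets, of which truncation keeps the first \<open>r\<close>.
\<close>

lemma truncated_svd_entries:
  assumes svd: "truncated_svd r M U S V" and M: "M \<in> carrier_mat m n"
  obtains u v \<sigma> where "r \<le> min m n" "S * mat_adjoint V \<in> carrier_mat r n"
    and "\<And>a b. a < m \<Longrightarrow> b < m \<Longrightarrow> inner_on {..<m} (u a) (u b) = (if a = b then 1 else 0)"
    and "\<And>a b. a < n \<Longrightarrow> b < n \<Longrightarrow> inner_on {..<n} (v a) (v b) = (if a = b then 1 else 0)"
    and "\<And>i. i < min m n \<Longrightarrow> 0 \<le> \<sigma> i"
    and "\<And>i j. i \<le> j \<Longrightarrow> j < min m n \<Longrightarrow> \<sigma> j \<le> \<sigma> i"
    and "\<And>i j. i < m \<Longrightarrow> j < n \<Longrightarrow>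
           M $$ (i, j) = (\<Sum>b<min m n. of_real (\<sigma> b) * cnj (v b j) * u b i)"
    and "\<And>i b. i < m \<Longrightarrow> b < r \<Longrightarrow> U $$ (i, b) = u b i"
    and "\<And>b j. b < r \<Longrightarrow> j < n \<Longrightarrow> (S * mat_adjoint V) $$ (b, j) = of_real (\<sigma> b) * cnj (v b j)"
proof -
  from svd M obtain W \<sigma> Z where r: "r \<le> min m n" and is_svd: "is_svd M W \<sigma> Z"
    and U: "U = mat m r (\<lambda>(i, j). W $$ (i, j))"
    and S: "S = mat r r (\<lambda>(i, j). if i = j then complex_of_real (\<sigma> i) else 0)"
    and V: "V = mat n r (\<lambda>(i, j). Z $$ (i, j))"
    unfolding truncated_svd_def by auto
  let ?D = "mat m n (\<lambda>(i, j). if i = j then complex_of_real (\<sigma> i) else 0)"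
  have W: "unitary_mat m W" and Z: "unitary_mat n Z" and Meq: "M = W * ?D * mat_adjoint Z"
    and \<sigma>0: "\<And>i. i < min m n \<Longrightarrow> 0 \<le> \<sigma> i"
    and \<sigma>: "\<And>i j. i \<le> j \<Longrightarrow> j < min m n \<Longrightarrow> \<sigma> j \<le> \<sigma> i"
    using is_svd M unfolding is_svd_def by auto
  have cW: "W \<in> carrier_mat m m" and cZ: "Z \<in> carrier_mat n n"
    using W Z unfolding unitary_mat_def by auto
  define u where "u = (\<lambda>b i. W $$ (i, b))"
  define v where "v = (\<lambda>b j. Z $$ (j, b))"
  have WD: "(W * ?D) $$ (i, b) = (if b < m then W $$ (i, b) * of_real (\<sigma> b) else 0)"
    if "i < m" "b < n" for i b
  proof -
    have "(W * ?D) $$ (i, b) = (\<Sum>a<m. W $$ (i, a) * (if a = b then of_real (\<sigma> a) else 0))"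
      using cW that by (auto simp: scalar_prod_def atLeast0LessThan intro!: sum.cong)
    also have "\<dots> = (if b < m then W $$ (i, b) * of_real (\<sigma> b) else 0)"
      by (simp add: if_distrib[of "(*) _"] sum.delta cong: if_cong)
    finally show ?thesis .
  qed
  have entries: "M $$ (i, j) = (\<Sum>b<min m n. of_real (\<sigma> b) * cnj (v b j) * u b i)"
    if "i < m" "j < n" for i j
  proof -
    have "M $$ (i, j) = (\<Sum>b<n. (W * ?D) $$ (i, b) * cnj (Z $$ (j, b)))"
      unfolding Meq using cW cZ that
      by (subst index_mult_mat) (auto simp: scalar_prod_def atLeast0LessThan index_mat_adjoint
          simp del: index_mult_mat(1) intro!: sum.cong)
    also have "\<dots> = (\<Sum>b<min m n. (W * ?D) $$ (i, b) * cnj (Z $$ (j, b)))"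
      using that by (intro sum.mono_neutral_right) (auto simp: WD simp del: index_mult_mat(1))
    also have "\<dots> = (\<Sum>b<min m n. of_real (\<sigma> b) * cnj (v b j) * u b i)"
      using that by (intro sum.cong) (auto simp: WD u_def v_def simp del: index_mult_mat(1))
    finally show ?thesis .
  qed
  have T: "(S * mat_adjoint V) $$ (b, j) = of_real (\<sigma> b) * cnj (v b j)" if "b < r" "j < n" for b j
  proof -
    have "(S * mat_adjoint V) $$ (b, j) =
        (\<Sum>a<r. (if b = a then of_real (\<sigma> b) else 0) * cnj (Z $$ (j, a)))"
      using that unfolding S V
      by (auto simp: scalar_prod_def index_mat_adjoint atLeast0LessThan intro!: sum.cong)
    also have "\<dots> = of_real (\<sigma> b) * cnj (v b j)"
      using that by (simp add: if_distrib[of "\<lambda>x. x * _"] sum.delta v_def cong: if_cong)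
    finally show ?thesis .
  qed
  show ?thesis
    by (rule that[of u v \<sigma>])
      (use r U S V W Z \<sigma>0 \<sigma> entries T in
        \<open>auto simp: u_def v_def inner_on_def unitary_mat_columns\<close>)
qed

lemma sqnorm_on_orthonormal_sum:
  fixes p :: nat
  assumes "\<And>a b. a < p \<Longrightarrow> b < p \<Longrightarrow> inner_on I (v a) (v b) = (if a = b then 1 else 0)"
  shows "sqnorm_on I (\<lambda>j. \<Sum>b<p. c b * v b j) = (\<Sum>b<p. (cmod (c b))\<^sup>2)"
proof -
  have "complex_of_real (sqnorm_on I (\<lambda>j. \<Sum>b<p. c b * v b j)) =
      (\<Sum>a<p. cnj (c a) * (\<Sum>b<p. c b * inner_on I (v a) (v b)))"
    unfolding inner_on_self[symmetric] inner_on_sum_left inner_on_sum_right ..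
  also have "\<dots> = (\<Sum>a<p. cnj (c a) * c a)"
  proof (intro sum.cong refl)
    fix a assume a: "a \<in> {..<p}"
    have "(\<Sum>b<p. c b * inner_on I (v a) (v b)) = (\<Sum>b<p. if b = a then c b else 0)"
      using a by (intro sum.cong) (auto simp: assms)
    also have "\<dots> = c a" using a by (subst sum.delta) auto
    finally show "cnj (c a) * (\<Sum>b<p. c b * inner_on I (v a) (v b)) = cnj (c a) * c a"
      by simp
  qed
  also have "\<dots> = complex_of_real (\<Sum>b<p. (cmod (c b))\<^sup>2)"
    unfolding of_real_sum
    by (intro sum.cong refl) (metis complex_norm_square mult.commute of_real_power)
  finally show ?thesis unfolding of_real_eq_iff .
qed

text \<open>
  Compared with mass 1 on each of the first \<open>r\<close> positions, \<open>q\<close> has moved mass from positions where the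
  weight is at least \<open>w r\<close> to positions where it is at most \<open>w r\<close>.
\<close>

lemma weighted_sum_le_leading_sum:
  fixes w q :: "nat \<Rightarrow> real"
  assumes rp: "r \<le> p" and w: "\<And>i j. i \<le> j \<Longrightarrow> j < p \<Longrightarrow> w j \<le> w i"
    and w0: "\<And>i. i < p \<Longrightarrow> 0 \<le> w i"
    and q: "\<And>i. i < p \<Longrightarrow> 0 \<le> q i" "\<And>i. i < p \<Longrightarrow> q i \<le> 1"
    and total: "(\<Sum>i<p. q i) \<le> real r"
  shows "(\<Sum>i<p. w i * q i) \<le> (\<Sum>i<r. w i)"
proof -
  \<comment> \<open>The default 0 serves the case in which all weights are leading.\<close>
  define s where "s = (if r < p then w r else 0)"
  have s0: "0 \<le> s" using w0 by (simp add: s_def)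
  have "w i * q i \<le> (if i < r then w i else 0) + s * (q i - (if i < r then 1 else 0))" if "i < p" for i
  proof (cases "i < r")
    case True
    then have "s \<le> w i" using w[of i r] w0[OF that] by (auto simp: s_def)
    then have "s * (1 - q i) \<le> w i * (1 - q i)" using q(2)[OF that] by (intro mult_right_mono) auto
    then show ?thesis using True by (simp add: algebra_simps)
  next
    case False
    then have "w i \<le> s" using w[of r i] that by (auto simp: s_def)
    then have "w i * q i \<le> s * q i" using q(1)[OF that] by (intro mult_right_mono) auto
    then show ?thesis using False by simp
  qed
  then have "(\<Sum>i<p. w i * q i) \<le>
      (\<Sum>i<p. (if i < r then w i else 0) + s * (q i - (if i < r then 1 else 0)))"
    by (intro sum_mono) auto
  also have "\<dots> = (\<Sum>i<p. if i < r then w i else 0) + s * ((\<Sum>i<p. q i) - (\<Sum>i<p. if i < r then 1 else 0))"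
    by (simp add: sum.distrib sum_subtractf flip: sum_distrib_left)
  also have "(\<Sum>i<p. if i < r then w i else 0) = (\<Sum>i<r. w i)"
    using rp by (intro sum.mono_neutral_cong_right) auto
  also have "(\<Sum>i<p. if i < r then 1 else (0::real)) = (\<Sum>i<r. 1)"
    using rp by (intro sum.mono_neutral_cong_right) auto
  also have "s * ((\<Sum>i<p. q i) - (\<Sum>i<r. 1)) \<le> 0"
    using s0 total by (intro mult_nonneg_nonpos) auto
  finally show ?thesis by simp
qed

text \<open>
  The Eckart-Young inequality in the Frobenius norm. The competitor has rank at most \<open>r\<close>, given by the
  factors \<open>F\<close> and \<open>G\<close>; the left-hand side is the squared error of the truncation, as \<open>S V\<^sup>*\<close> carries
  the energy that is kept.

  Let \<open>e\<close> be an orthogonal family spanning the columns of \<open>F\<close>. The competitor is no better than the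
  projection of the columns of \<open>M\<close> onto \<open>e\<close>, which captures the energy \<open>\<Sum>\<^sub>b \<sigma>\<^sub>b\<^sup>2 q\<^sub>b\<close>, where \<open>q\<^sub>b\<close> is the
  squared length of the projection of \<open>u\<^sub>b\<close> onto \<open>e\<close>. By Bessel, each \<open>q\<^sub>b\<close> is at most 1 and their sum is at
  most \<open>r\<close>, so the captured energy is at most the sum of the \<open>r\<close> largest \<open>\<sigma>\<^sub>b\<^sup>2\<close>.
\<close>

lemma truncated_svd_optimal:
  assumes svd: "truncated_svd r M U S V" and M: "M \<in> carrier_mat m n"
  shows "(\<Sum>i<m. \<Sum>j<n. (cmod (M $$ (i, j)))\<^sup>2)
      - (\<Sum>b<r. \<Sum>j<n. (cmod ((S * mat_adjoint V) $$ (b, j)))\<^sup>2)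
    \<le> (\<Sum>i<m. \<Sum>j<n. (cmod (M $$ (i, j) - (\<Sum>b<r. F i b * G b j)))\<^sup>2)"
proof -
  define p where "p = min m n"
  obtain u v \<sigma> where rp: "r \<le> p" and Tc: "S * mat_adjoint V \<in> carrier_mat r n"
    and u: "\<And>a b. a < m \<Longrightarrow> b < m \<Longrightarrow> inner_on {..<m} (u a) (u b) = (if a = b then 1 else 0)"
    and v: "\<And>a b. a < n \<Longrightarrow> b < n \<Longrightarrow> inner_on {..<n} (v a) (v b) = (if a = b then 1 else 0)"
    and \<sigma>0: "\<And>i. i < p \<Longrightarrow> 0 \<le> \<sigma> i"
    and \<sigma>: "\<And>i j. i \<le> j \<Longrightarrow> j < p \<Longrightarrow> \<sigma> j \<le> \<sigma> i"
    and Mij: "\<And>i j. i < m \<Longrightarrow> j < n \<Longrightarrow>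
           M $$ (i, j) = (\<Sum>b<p. of_real (\<sigma> b) * cnj (v b j) * u b i)"
    and U: "\<And>i b. i < m \<Longrightarrow> b < r \<Longrightarrow> U $$ (i, b) = u b i"
    and T: "\<And>b j. b < r \<Longrightarrow> j < n \<Longrightarrow> (S * mat_adjoint V) $$ (b, j) = of_real (\<sigma> b) * cnj (v b j)"
    by (rule truncated_svd_entries[OF svd M, folded p_def]) (rule that, assumption+)
  have pm: "b < m" "b < n" if "b < p" for b using that by (auto simp: p_def)
  obtain e K where e: "orthogonal_family {..<m} r e"
    and K: "\<And>a i. a < r \<Longrightarrow> i < m \<Longrightarrow> F i a = (\<Sum>b<r. K a b * e b i)"
    using gram_schmidt_family[of "{..<m}" r "\<lambda>a i. F i a"] by auto
  define x where "x = (\<lambda>j i. M $$ (i, j))"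
  define q where "q = (\<lambda>b. \<Sum>c<r. (cmod (inner_on {..<m} (e c) (u b)))\<^sup>2)"
  have su: "sqnorm_on {..<m} (u b) = 1" if "b < p" for b
    using u[of b b] pm[OF that] by (simp add: inner_on_self)
  have col: "inner_on {..<m} (e c) (x j) =
      (\<Sum>b<p. of_real (\<sigma> b) * cnj (v b j) * inner_on {..<m} (e c) (u b))" if "j < n" for c j
    unfolding inner_on_sum_right[symmetric] using that
    by (intro inner_on_cong) (auto simp: x_def Mij)
  \<comment> \<open>The right singular vectors are orthonormal, so the sum over the columns decouples.\<close>
  have captured: "(\<Sum>j<n. (cmod (inner_on {..<m} (e c) (x j)))\<^sup>2) =
      (\<Sum>b<p. (\<sigma> b)\<^sup>2 * (cmod (inner_on {..<m} (e c) (u b)))\<^sup>2)" for c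
  proof -
    have "cmod (inner_on {..<m} (e c) (x j)) =
        cmod (\<Sum>b<p. (of_real (\<sigma> b) * cnj (inner_on {..<m} (e c) (u b))) * v b j)" if "j < n" for j
      unfolding col[OF that] by (subst complex_mod_cnj[symmetric]) (simp add: cnj_sum mult_ac)
    then have "(\<Sum>j<n. (cmod (inner_on {..<m} (e c) (x j)))\<^sup>2) =
        sqnorm_on {..<n} (\<lambda>j. \<Sum>b<p. (of_real (\<sigma> b) * cnj (inner_on {..<m} (e c) (u b))) * v b j)"
      unfolding sqnorm_on_def by (intro sum.cong) auto
    also have "\<dots> = (\<Sum>b<p. (cmod (of_real (\<sigma> b) * cnj (inner_on {..<m} (e c) (u b))))\<^sup>2)"
      by (rule sqnorm_on_orthonormal_sum) (auto simp: v pm)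
    finally show ?thesis by (simp add: norm_mult power_mult_distrib)
  qed
  have q1: "q b \<le> 1" if "b < p" for b
    using bessel_inequality[OF _ e, of "u b"] su[OF that] by (simp add: q_def)
  \<comment> \<open>Bessel again, now with the left singular vectors as the family and \<open>e\<^sub>c\<close> as the vector.\<close>
  have q_total: "(\<Sum>b<p. q b) \<le> real r"
  proof -
    have ou: "orthogonal_family {..<m} p u"
      unfolding orthogonal_family_def using u pm su by auto
    have "(\<Sum>b<p. q b) = (\<Sum>c<r. \<Sum>b<p. (cmod (inner_on {..<m} (u b) (e c)))\<^sup>2)"
      unfolding q_def
      by (subst sum.swap, intro sum.cong refl, subst inner_on_commute, simp)
    also have "\<dots> \<le> (\<Sum>c<r. sqnorm_on {..<m} (e c))"
      by (intro sum_mono bessel_inequality[OF _ ou]) simp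
    also have "\<dots> \<le> (\<Sum>c<r. 1)"
      using e unfolding orthogonal_family_def by (intro sum_mono) force
    finally show ?thesis by simp
  qed
  have "(\<Sum>j<n. \<Sum>c<r. (cmod (inner_on {..<m} (e c) (x j)))\<^sup>2) = (\<Sum>b<p. (\<sigma> b)\<^sup>2 * q b)"
    unfolding q_def sum_distrib_left
    by (subst sum.swap, subst (2) sum.swap, simp add: captured)
  also have "\<dots> \<le> (\<Sum>b<r. (\<sigma> b)\<^sup>2)"
    using rp q1 q_total \<sigma> \<sigma>0
    by (intro weighted_sum_le_leading_sum) (auto simp: q_def sum_nonneg intro: power_mono)
  also have "\<dots> = (\<Sum>b<r. \<Sum>j<n. (cmod ((S * mat_adjoint V) $$ (b, j)))\<^sup>2)"
  proof (intro sum.cong refl)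
    fix b assume "b \<in> {..<r}"
    then have b: "b < r" "b < p" using rp by auto
    have "(\<Sum>j<n. (cmod ((S * mat_adjoint V) $$ (b, j)))\<^sup>2) = (\<sigma> b)\<^sup>2 * sqnorm_on {..<n} (v b)"
      using b by (simp add: T norm_mult power_mult_distrib sqnorm_on_def sum_distrib_left)
    also have "sqnorm_on {..<n} (v b) = 1"
      using v[of b b] pm[OF b(2)] by (simp add: inner_on_self)
    finally show "(\<sigma> b)\<^sup>2 = (\<Sum>j<n. (cmod ((S * mat_adjoint V) $$ (b, j)))\<^sup>2)" by simp
  qed
  finally have main: "(\<Sum>j<n. \<Sum>c<r. (cmod (inner_on {..<m} (e c) (x j)))\<^sup>2) \<le>
      (\<Sum>b<r. \<Sum>j<n. (cmod ((S * mat_adjoint V) $$ (b, j)))\<^sup>2)" .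
  have "sqnorm_on {..<m} (x j) - (\<Sum>c<r. (cmod (inner_on {..<m} (e c) (x j)))\<^sup>2)
      \<le> (\<Sum>i<m. (cmod (M $$ (i, j) - (\<Sum>b<r. F i b * G b j)))\<^sup>2)" for j
  proof -
    have FG: "(\<Sum>b<r. F i b * G b j) = (\<Sum>c<r. (\<Sum>b<r. K b c * G b j) * e c i)" if "i < m" for i
    proof -
      have "(\<Sum>b<r. F i b * G b j) = (\<Sum>b<r. \<Sum>c<r. K b c * e c i * G b j)"
        using that by (intro sum.cong) (auto simp: K sum_distrib_right)
      also have "\<dots> = (\<Sum>c<r. (\<Sum>b<r. K b c * G b j) * e c i)"
        by (subst sum.swap) (simp add: sum_distrib_left sum_distrib_right mult_ac)
      finally show ?thesis .
    qed
    have "(\<Sum>i<m. (cmod (M $$ (i, j) - (\<Sum>b<r. F i b * G b j)))\<^sup>2) =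
        sqnorm_on {..<m} (\<lambda>i. x j i - (\<Sum>c<r. (\<Sum>b<r. K b c * G b j) * e c i))"
      unfolding sqnorm_on_def by (intro sum.cong) (auto simp: FG x_def)
    then show ?thesis using sqnorm_residual_le[OF _ e, of "x j"] by simp
  qed
  then have "(\<Sum>j<n. sqnorm_on {..<m} (x j) - (\<Sum>c<r. (cmod (inner_on {..<m} (e c) (x j)))\<^sup>2))
      \<le> (\<Sum>j<n. \<Sum>i<m. (cmod (M $$ (i, j) - (\<Sum>b<r. F i b * G b j)))\<^sup>2)"
    by (intro sum_mono)
  moreover have "(\<Sum>j<n. sqnorm_on {..<m} (x j)) = (\<Sum>i<m. \<Sum>j<n. (cmod (M $$ (i, j)))\<^sup>2)"
    unfolding sqnorm_on_def x_def by (rule sum.swap)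
  ultimately show ?thesis
    using main unfolding sum_subtractf
    by (subst sum.swap[of "\<lambda>i j. (cmod (M $$ (i, j) - (\<Sum>b<r. F i b * G b j)))\<^sup>2"]) linarith
qed

text \<open>
  The truncated factor \<open>U\<close> has orthonormal columns and \<open>S V\<^sup>* = U\<^sup>* M\<close>, so the algorithm passes on
  the coordinates of the columns of \<open>M\<close> in the basis it has chosen.
\<close>

lemma truncated_svd_coefficients:
  assumes svd: "truncated_svd r M U S V" and M: "M \<in> carrier_mat m n"
  shows "S * mat_adjoint V \<in> carrier_mat r n"
    and "\<And>a b. a < r \<Longrightarrow> b < r \<Longrightarrow> (\<Sum>i<m. cnj (U $$ (i, a)) * U $$ (i, b)) = (if a = b then 1 else 0)"
    and "\<And>b j. b < r \<Longrightarrow> j < n \<Longrightarrow>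
      (S * mat_adjoint V) $$ (b, j) = (\<Sum>i<m. cnj (U $$ (i, b)) * M $$ (i, j))"
proof -
  define p where "p = min m n"
  obtain u v \<sigma> where rp: "r \<le> p" and Tc: "S * mat_adjoint V \<in> carrier_mat r n"
    and u: "\<And>a b. a < m \<Longrightarrow> b < m \<Longrightarrow> inner_on {..<m} (u a) (u b) = (if a = b then 1 else 0)"
    and v: "\<And>a b. a < n \<Longrightarrow> b < n \<Longrightarrow> inner_on {..<n} (v a) (v b) = (if a = b then 1 else 0)"
    and \<sigma>0: "\<And>i. i < p \<Longrightarrow> 0 \<le> \<sigma> i"
    and \<sigma>: "\<And>i j. i \<le> j \<Longrightarrow> j < p \<Longrightarrow> \<sigma> j \<le> \<sigma> i"
    and Mij: "\<And>i j. i < m \<Longrightarrow> j < n \<Longrightarrow>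
           M $$ (i, j) = (\<Sum>b<p. of_real (\<sigma> b) * cnj (v b j) * u b i)"
    and U: "\<And>i b. i < m \<Longrightarrow> b < r \<Longrightarrow> U $$ (i, b) = u b i"
    and T: "\<And>b j. b < r \<Longrightarrow> j < n \<Longrightarrow> (S * mat_adjoint V) $$ (b, j) = of_real (\<sigma> b) * cnj (v b j)"
    by (rule truncated_svd_entries[OF svd M, folded p_def]) (rule that, assumption+)
  have rm: "r \<le> m" using rp by (simp add: p_def)
  show "S * mat_adjoint V \<in> carrier_mat r n" by fact
  show "(\<Sum>i<m. cnj (U $$ (i, a)) * U $$ (i, b)) = (if a = b then 1 else 0)" if "a < r" "b < r" for a b
    using u[of a b] that rm by (simp add: U inner_on_def)
  show "(S * mat_adjoint V) $$ (b, j) = (\<Sum>i<m. cnj (U $$ (i, b)) * M $$ (i, j))"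
    if b: "b < r" and j: "j < n" for b j
  proof -
    have "(\<Sum>i<m. cnj (U $$ (i, b)) * M $$ (i, j)) =
        inner_on {..<m} (u b) (\<lambda>i. \<Sum>a<p. (of_real (\<sigma> a) * cnj (v a j)) * u a i)"
      unfolding inner_on_def using b j by (intro sum.cong) (auto simp: U Mij)
    also have "\<dots> = (\<Sum>a<p. if a = b then of_real (\<sigma> a) * cnj (v a j) else 0)"
      unfolding inner_on_sum_right using b rm by (intro sum.cong) (auto simp: u p_def)
    also have "\<dots> = of_real (\<sigma> b) * cnj (v b j)" using b rp by (simp add: sum.delta)
    finally show ?thesis using T[OF b j] by simp
  qed
qed

text \<open>
  The leading singular value is the largest one: if it vanishes, all of them do.
\<close>

lemma truncated_svd_zero:
  assumes svd: "truncated_svd r M U S V" and M: "M \<in> carrier_mat m n" and r: "1 \<le> r"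
    and zero: "\<And>b j. b < r \<Longrightarrow> j < n \<Longrightarrow> (S * mat_adjoint V) $$ (b, j) = 0"
    and ij: "i < m" "j < n"
  shows "M $$ (i, j) = 0"
proof -
  define p where "p = min m n"
  obtain u v \<sigma> where rp: "r \<le> p" and Tc: "S * mat_adjoint V \<in> carrier_mat r n"
    and u: "\<And>a b. a < m \<Longrightarrow> b < m \<Longrightarrow> inner_on {..<m} (u a) (u b) = (if a = b then 1 else 0)"
    and v: "\<And>a b. a < n \<Longrightarrow> b < n \<Longrightarrow> inner_on {..<n} (v a) (v b) = (if a = b then 1 else 0)"
    and \<sigma>0: "\<And>i. i < p \<Longrightarrow> 0 \<le> \<sigma> i"
    and \<sigma>: "\<And>i j. i \<le> j \<Longrightarrow> j < p \<Longrightarrow> \<sigma> j \<le> \<sigma> i"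
    and Mij: "\<And>i j. i < m \<Longrightarrow> j < n \<Longrightarrow>
           M $$ (i, j) = (\<Sum>b<p. of_real (\<sigma> b) * cnj (v b j) * u b i)"
    and U: "\<And>i b. i < m \<Longrightarrow> b < r \<Longrightarrow> U $$ (i, b) = u b i"
    and T: "\<And>b j. b < r \<Longrightarrow> j < n \<Longrightarrow> (S * mat_adjoint V) $$ (b, j) = of_real (\<sigma> b) * cnj (v b j)"
    by (rule truncated_svd_entries[OF svd M, folded p_def]) (rule that, assumption+)
  have n: "0 < n" "0 < p" using rp r by (auto simp: p_def)
  have "\<exists>l<n. v 0 l \<noteq> 0"
    using v[of 0 0] n by (auto simp: inner_on_def intro: ccontr)
  then have "\<sigma> 0 = 0" using T[of 0] zero[of 0] r by auto
  then have "\<sigma> b = 0" if "b < p" for b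
    using \<sigma>[of 0 b] \<sigma>0[of b] that by auto
  then show ?thesis using Mij[OF ij] by simp
qed

section \<open>Matrix rank, factorizations and determinants\<close>

lemma mult_mat_entry:
  assumes "A \<in> carrier_mat m n" "B \<in> carrier_mat n l" "i < m" "j < l"
  shows "(A * B) $$ (i, j) = (\<Sum>k<n. A $$ (i, k) * B $$ (k, j))"
  using assms by (auto simp: scalar_prod_def atLeast0LessThan intro!: sum.cong)

lemma mult_mat_unit_vec:
  assumes A: "(A :: 'a :: semiring_1 mat) \<in> carrier_mat m n" and j: "j < n"
  shows "A *\<^sub>v unit_vec n j = col A j"
proof (rule eq_vecI)
  fix i assume "i < dim_vec (col A j)"
  then have "i < m" using A by simp
  then show "(A *\<^sub>v unit_vec n j) $ i = col A j $ i"
    using A j by simp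
qed (use A in simp)

text \<open>
  A maximal independent set of columns spans all columns and has \<open>rank M\<close> elements; \<open>R\<close> selects these
  columns and \<open>G\<close> expresses all columns in terms of them.
\<close>

lemma (in vec_space) rank_column_basis:
  assumes M: "M \<in> carrier_mat n nc"
  obtains C G R where "C \<in> carrier_mat n (rank M)" "G \<in> carrier_mat (rank M) nc"
    "R \<in> carrier_mat nc (rank M)" "M = C * G" "C = M * R"
    "\<And>v. v \<in> carrier_vec (rank M) \<Longrightarrow> C *\<^sub>v v = 0\<^sub>v n \<Longrightarrow> v = 0\<^sub>v (rank M)"
proof -
  define P where "P = (\<lambda>T. T \<subseteq> set (cols M) \<and> lin_indpt T)"
  have cM: "set (cols M) \<subseteq> carrier_vec n" using M cols_dim by blast
  have "P {}" unfolding P_def lin_dep_def by auto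
  then obtain S where S: "maximal S P" "finite S"
    using maximal_exists_superset[of "set (cols M)" P "{}"] unfolding P_def by blast
  then have SM: "S \<subseteq> set (cols M)" and ind: "lin_indpt S" unfolding maximal_def P_def by blast+
  have cS: "S \<subseteq> carrier_vec n" using SM cM by blast
  have r: "rank M = card S" using rank_card_indpt[OF M] S unfolding P_def by blast
  obtain us where us: "set us = S" "distinct us" using finite_distinct_list[OF S(2)] by blast
  have len: "length us = rank M" using r us distinct_card by metis
  define C where "C = mat_of_cols n us"
  have C: "C \<in> carrier_mat n (rank M)" using len unfolding C_def by (metis mat_of_cols_carrier(1))
  have colsC: "cols C = us" unfolding C_def using us cS by simp
  have in_span: "c \<in> span S" if "c \<in> set (cols M)" for c
  proof (rule ccontr)
    assume nc: "c \<notin> span S"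
    have cc: "c \<in> carrier_vec n" using that cM by blast
    have cnS: "c \<notin> S" using nc span_mem[OF cS] by blast
    then have "lin_indpt (S \<union> {c})" using lin_dep_iff_in_span[of S c] cS ind cc nc by simp
    then have "P (S \<union> {c})" using that SM unfolding P_def by blast
    then show False using S(1) cnS unfolding maximal_def by blast
  qed
  have "\<exists>w. w \<in> carrier_vec (rank M) \<and> C *\<^sub>v w = col M j" if "j < nc" for j
  proof -
    have "col M j \<in> set (cols M)" using that M by (metis carrier_matD(2) cols_length cols_nth nth_mem)
    then obtain a where "lincomb a S = col M j" using finite_in_span[OF S(2), of "col M j"] cS in_span by auto
    then have "C *\<^sub>v vec (rank M) (\<lambda>i. a (col C i)) = col M j"
      using mat_mult_eq_lincomb[OF C, of a] colsC us by simp
    then show ?thesis by (intro exI[of _ "vec (rank M) (\<lambda>i. a (col C i))"]) simp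
  qed
  then obtain w where w: "\<And>j. j < nc \<Longrightarrow> w j \<in> carrier_vec (rank M)"
    "\<And>j. j < nc \<Longrightarrow> C *\<^sub>v w j = col M j" by metis
  define G where "G = mat_of_cols (rank M) (map w [0..<nc])"
  have G: "G \<in> carrier_mat (rank M) nc"
    unfolding G_def using mat_of_cols_carrier(1)[of "rank M" "map w [0..<nc]"] by simp
  have colG: "col G j = w j" if "j < nc" for j
    unfolding G_def using that w(1) by (subst col_mat_of_cols) auto
  have MCG: "M = C * G"
  proof (rule mat_col_eqI)
    fix j assume "j < dim_col (C * G)"
    then have j: "j < nc" using G by simp
    show "col M j = col (C * G) j" using col_mult2[OF C G j] colG[OF j] w(2)[OF j] by simp
  qed (use M C G in auto)
  have "\<exists>k. k < nc \<and> col M k = col C b" if "b < rank M" for b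
  proof -
    have "col C b \<in> S" using that C colsC us len by (metis carrier_matD(2) cols_nth nth_mem)
    then show ?thesis using SM M by (metis carrier_matD(2) cols_length cols_nth in_set_conv_nth subsetD)
  qed
  then obtain k where k: "\<And>b. b < rank M \<Longrightarrow> k b < nc" "\<And>b. b < rank M \<Longrightarrow> col M (k b) = col C b"
    by metis
  define R :: "'a mat" where "R = mat nc (rank M) (\<lambda>(i, b). if i = k b then 1 else 0)"
  have R: "R \<in> carrier_mat nc (rank M)" unfolding R_def by simp
  have CMR: "C = M * R"
  proof (rule mat_col_eqI)
    fix b assume "b < dim_col (M * R)"
    then have b: "b < rank M" using R by simp
    have "col R b = unit_vec nc (k b)" using b k(1)[OF b] by (intro eq_vecI) (auto simp: R_def)
    then show "col C b = col (M * R) b"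
      using col_mult2[OF M R b] k[OF b] mult_mat_unit_vec[OF M k(1)[OF b]] by simp
  qed (use M C R in auto)
  have inj: "v = 0\<^sub>v (rank M)" if "v \<in> carrier_vec (rank M)" "C *\<^sub>v v = 0\<^sub>v n" for v
    using lin_depI[OF C that(1) _ that(2)] ind colsC us by metis
  show ?thesis by (rule that[OF C G R MCG CMR inj])
qed

text \<open>
  Over the complex numbers \<open>C\<^sup>* C\<close> is invertible, because \<open>C\<^sup>* C v = 0\<close> implies \<open>\<parallel>C v\<parallel>\<^sup>2 = 0\<close>.
\<close>

lemma left_inverse_of_injective:
  assumes C: "(C :: complex mat) \<in> carrier_mat m r"
    and inj: "\<And>v. v \<in> carrier_vec r \<Longrightarrow> C *\<^sub>v v = 0\<^sub>v m \<Longrightarrow> v = 0\<^sub>v r"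
  obtains L where "L \<in> carrier_mat r m" "L * C = 1\<^sub>m r"
proof -
  define H where "H = mat_adjoint C"
  have H: "H \<in> carrier_mat r m" using C unfolding H_def carrier_mat_def by simp
  have HC: "H * C \<in> carrier_mat r r" using H C by simp
  have "v = 0\<^sub>v r" if v: "v \<in> carrier_vec r" and z: "(H * C) *\<^sub>v v = 0\<^sub>v r" for v
  proof -
    define w where "w = C *\<^sub>v v"
    have w: "w \<in> carrier_vec m" unfolding w_def using C v by simp
    have "H *\<^sub>v w = 0\<^sub>v r" unfolding w_def using z H C v by (simp add: assoc_mult_mat_vec)
    have Hw: "(\<Sum>i<m. cnj (C $$ (i, a)) * w $ i) = 0" if "a < r" for a
    proof -
      have "(H *\<^sub>v w) $ a = (\<Sum>i<m. cnj (C $$ (i, a)) * w $ i)"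
        using that H C w by (auto simp: scalar_prod_def H_def index_mat_adjoint atLeast0LessThan intro!: sum.cong)
      then show ?thesis using \<open>H *\<^sub>v w = 0\<^sub>v r\<close> that by simp
    qed
    have wi: "w $ i = (\<Sum>a<r. v $ a * C $$ (i, a))" if "i < m" for i
      unfolding w_def using that C v by (auto simp: scalar_prod_def atLeast0LessThan mult.commute intro!: sum.cong)
    have "inner_on {..<m} (($) w) (($) w) =
        inner_on {..<m} (\<lambda>i. \<Sum>a<r. v $ a * C $$ (i, a)) (($) w)"
      by (intro inner_on_cong) (auto simp: wi)
    also have "\<dots> = (\<Sum>a<r. cnj (v $ a) * inner_on {..<m} (\<lambda>i. C $$ (i, a)) (($) w))"
      by (rule inner_on_sum_left)
    also have "\<dots> = 0" using Hw by (simp add: inner_on_def)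
    finally have "sqnorm_on {..<m} (($) w) = 0" by (simp add: inner_on_self)
    then have "w = 0\<^sub>v m" using w by (intro eq_vecI) (auto simp: sqnorm_on_zero_iff)
    then show ?thesis using inj[OF v] unfolding w_def by simp
  qed
  then have "det (H * C) \<noteq> 0" using det_0_iff_vec_prod_zero_field[OF HC] by blast
  then have "H * C \<in> Units (ring_mat TYPE(complex) r ())" by (rule det_non_zero_imp_unit[OF HC])
  then obtain B where B: "B \<in> carrier_mat r r" "B * (H * C) = 1\<^sub>m r"
    unfolding Units_def ring_mat_def by auto
  show ?thesis
    by (rule that[of "B * H"]) (use B H C in \<open>auto simp: assoc_mult_mat\<close>)
qed

text \<open>
  The single fact about the rank from which all others below are derived: \<open>M R\<close> and \<open>L M\<close> are a full
  rank factorization whose right factor consists of combinations of rows of \<open>M\<close>, and the compression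
  \<open>L M R\<close> is a witness for the rank that can be tested by a determinant.
\<close>

lemma mat_rank_factorization:
  assumes M: "M \<in> carrier_mat m n"
  obtains L R where "L \<in> carrier_mat (mat_rank M) m" "R \<in> carrier_mat n (mat_rank M)"
    "L * M * R = 1\<^sub>m (mat_rank M)" "(M * R) * (L * M) = M"
proof -
  have r: "mat_rank M = vec_space.rank m M" using M unfolding mat_rank_def by simp
  obtain C G R where C: "C \<in> carrier_mat m (mat_rank M)" and G: "G \<in> carrier_mat (mat_rank M) n"
    and R: "R \<in> carrier_mat n (mat_rank M)" and MCG: "M = C * G" and CMR: "C = M * R"
    and inj: "\<And>v. v \<in> carrier_vec (mat_rank M) \<Longrightarrow> C *\<^sub>v v = 0\<^sub>v m \<Longrightarrow> v = 0\<^sub>v (mat_rank M)"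
    by (rule vec_space.rank_column_basis[OF M, folded r]) (rule that, assumption+)
  obtain L where L: "L \<in> carrier_mat (mat_rank M) m" and LC: "L * C = 1\<^sub>m (mat_rank M)"
    using left_inverse_of_injective[OF C inj] by blast
  have LM: "L * M = G"
    unfolding MCG using L C G LC by (simp add: assoc_mult_mat[symmetric])
  show ?thesis
  proof (rule that[OF L R])
    show "L * M * R = 1\<^sub>m (mat_rank M)" using L M R CMR LC by (simp add: assoc_mult_mat)
    show "M * R * (L * M) = M" unfolding LM CMR[symmetric] using MCG by simp
  qed
qed

text \<open>
  Padding the factors with zeros to square matrices gives a left factor with a zero column.
\<close>

lemma det_mult_narrow:
  assumes A: "(A :: 'a :: field mat) \<in> carrier_mat r s" and B: "B \<in> carrier_mat s r" and sr: "s < r"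
  shows "det (A * B) = 0"
proof -
  define A' where "A' = mat r r (\<lambda>(i, j). if j < s then A $$ (i, j) else 0)"
  define B' where "B' = mat r r (\<lambda>(i, j). if i < s then B $$ (i, j) else 0)"
  have cA: "A' \<in> carrier_mat r r" and cB: "B' \<in> carrier_mat r r" unfolding A'_def B'_def by auto
  have "A * B = A' * B'"
  proof (rule eq_matI)
    fix i j assume "i < dim_row (A' * B')" "j < dim_col (A' * B')"
    then have ij: "i < r" "j < r" using cA cB by auto
    have "(A' * B') $$ (i, j) = (\<Sum>k<r. if k < s then A $$ (i, k) * B $$ (k, j) else 0)"
      using ij by (auto simp: A'_def B'_def scalar_prod_def atLeast0LessThan intro!: sum.cong)
    also have "\<dots> = (\<Sum>k<s. A $$ (i, k) * B $$ (k, j))"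
      using sr by (intro sum.mono_neutral_cong_right) auto
    also have "\<dots> = (A * B) $$ (i, j)"
      using ij A B by (auto simp: scalar_prod_def atLeast0LessThan intro!: sum.cong)
    finally show "(A * B) $$ (i, j) = (A' * B') $$ (i, j)" by simp
  qed (use A B cA cB in auto)
  moreover have "det A' = 0"
  proof -
    have s: "s < r" by fact
    have "A' *\<^sub>v unit_vec r s = 0\<^sub>v r"
      using mult_mat_unit_vec[OF cA s] s by (simp, intro eq_vecI) (auto simp: A'_def)
    moreover have "unit_vec r s \<noteq> (0\<^sub>v r :: 'a vec)"
      using s by (metis index_unit_vec(2) index_zero_vec(1) zero_neq_one)
    ultimately show ?thesis using det_0_iff_vec_prod_zero_field[OF cA] unit_vec_carrier by blast
  qed
  ultimately show ?thesis using det_mult[OF cA cB] by simp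
qed

text \<open>
  If the rank exceeded \<open>r\<close>, an identity matrix of size larger than \<open>r\<close> would factor through \<open>r\<close>
  dimensions.
\<close>

lemma mat_rank_le_factor:
  assumes F: "F \<in> carrier_mat m r" and G: "G \<in> carrier_mat r n"
  shows "mat_rank (F * G) \<le> r"
proof (rule ccontr)
  assume less: "\<not> mat_rank (F * G) \<le> r"
  obtain L R where L: "L \<in> carrier_mat (mat_rank (F * G)) m" and R: "R \<in> carrier_mat n (mat_rank (F * G))"
    and one: "L * (F * G) * R = 1\<^sub>m (mat_rank (F * G))"
    by (rule mat_rank_factorization[OF mult_carrier_mat[OF F G]])
  have "L * (F * G) * R = (L * F) * (G * R)"
    using L R F G assoc_mult_mat[OF L F G] assoc_mult_mat[OF mult_carrier_mat[OF L F] G R] by simp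
  moreover have "det ((L * F) * (G * R)) = 0"
    using less L R F G by (intro det_mult_narrow[of _ _ r]) auto
  ultimately have "det (1\<^sub>m (mat_rank (F * G)) :: complex mat) = 0" using one by simp
  then show False by simp
qed

text \<open>
  The converse direction: a compression of size \<open>r\<close> factors through \<open>mat_rank M\<close> dimensions. Unlike the
  rank itself, the determinant of a compression depends polynomially on \<open>M\<close>.
\<close>

lemma mat_rank_ge_nonzero_det:
  assumes M: "M \<in> carrier_mat m n" and L: "L \<in> carrier_mat r m" and R: "R \<in> carrier_mat n r"
    and det: "det (L * M * R) \<noteq> 0"
  shows "r \<le> mat_rank M"
proof (rule ccontr)
  assume less: "\<not> r \<le> mat_rank M"
  obtain L' R' where L': "L' \<in> carrier_mat (mat_rank M) m" and R': "R' \<in> carrier_mat n (mat_rank M)"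
    and M_eq: "(M * R') * (L' * M) = M"
    using mat_rank_factorization[OF M] by blast
  have "L * M * R = L * ((M * R') * (L' * M)) * R" unfolding M_eq ..
  also have "\<dots> = (L * (M * R')) * ((L' * M) * R)"
  proof -
    have X: "M * R' \<in> carrier_mat m (mat_rank M)" and Y: "L' * M \<in> carrier_mat (mat_rank M) n"
      using M L' R' by auto
    show ?thesis
      using assoc_mult_mat[OF L X Y] assoc_mult_mat[OF mult_carrier_mat[OF L X] Y R] by simp
  qed
  finally have "det (L * M * R) = 0"
    using less L R M L' R' det_mult_narrow[of "L * (M * R')" r "mat_rank M" "(L' * M) * R"] by auto
  then show False using det by simp
qed

section \<open>Multi-indices\<close>

lemma indices_Nil [simp]: "indices [] = {[]}"
  unfolding indices_def by auto

lemma Cons_in_indices [simp]: "i # ix \<in> indices (n # ns) \<longleftrightarrow> i < n \<and> ix \<in> indices ns"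
  unfolding indices_def by (auto simp: All_less_Suc2)

lemma length_in_indices: "ix \<in> indices ns \<Longrightarrow> length ix = length ns"
  unfolding indices_def by simp

lemma indices_Cons: "indices (n # ns) = (\<lambda>(i, ix). i # ix) ` ({..<n} \<times> indices ns)"
proof (intro equalityI subsetI)
  fix jx assume jx: "jx \<in> indices (n # ns)"
  then obtain i ix where "jx = i # ix" using length_in_indices by (metis length_Suc_conv)
  then show "jx \<in> (\<lambda>(i, ix). i # ix) ` ({..<n} \<times> indices ns)" using jx by auto
qed auto

lemma finite_indices [simp]: "finite (indices ns)"
  by (induction ns) (auto simp: indices_Cons)

lemma append_in_indices [simp]:
  "length ix = length xs \<Longrightarrow> ix @ jx \<in> indices (xs @ ys) \<longleftrightarrow> ix \<in> indices xs \<and> jx \<in> indices ys"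
  by (induction ix xs rule: list_induct2) auto

lemma indices_append: "indices (xs @ ys) = (\<lambda>(ix, jx). ix @ jx) ` (indices xs \<times> indices ys)"
proof (induction xs)
  case (Cons n xs)
  then show ?case by (fastforce simp: indices_Cons image_iff)
qed (auto simp: image_iff)

lemma sum_indices_append:
  "(\<Sum>ix\<in>indices (xs @ ys). f ix) = (\<Sum>ix\<in>indices xs. \<Sum>jx\<in>indices ys. f (ix @ jx))"
proof -
  have "inj_on (\<lambda>(ix, jx). ix @ jx) (indices xs \<times> indices ys)"
    by (auto simp: inj_on_def dest!: length_in_indices)
  then show ?thesis
    unfolding indices_append by (subst sum.reindex) (auto simp: sum.cartesian_product case_prod_beta)
qed

lemma sum_indices_take_drop:
  "(\<Sum>ix\<in>indices ns. f ix) = (\<Sum>ix\<in>indices (take k ns). \<Sum>jx\<in>indices (drop k ns). f (ix @ jx))"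
  using sum_indices_append[of f "take k ns" "drop k ns"] by simp

lemma sum_indices_singleton: "(\<Sum>ix\<in>indices [n]. f ix) = (\<Sum>i<n. f [i])"
proof -
  have "indices [n] = (\<lambda>i. [i]) ` {..<n}" by (auto simp: indices_Cons)
  then show ?thesis by (simp add: sum.reindex inj_on_def)
qed

fun linear_index :: "nat list \<Rightarrow> nat list \<Rightarrow> nat" where
  "linear_index (n # ns) (i # ix) = i + n * linear_index ns ix"
| "linear_index _ _ = 0"

lemma multi_index_in_indices: "p < prod_list ns \<Longrightarrow> multi_index ns p \<in> indices ns"
proof (induction ns arbitrary: p)
  case (Cons n ns)
  then have "0 < n" "p div n < prod_list ns"
    by (auto intro: gr0I simp: less_mult_imp_div_less mult.commute)
  then show ?case using Cons.IH by simp
qed simp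

lemma linear_index_multi_index: "p < prod_list ns \<Longrightarrow> linear_index ns (multi_index ns p) = p"
proof (induction ns arbitrary: p)
  case (Cons n ns)
  then have "p div n < prod_list ns"
    by (auto simp: less_mult_imp_div_less mult.commute)
  then show ?case using Cons.IH by simp
qed simp

lemma mixed_radix_less: "a < (r::nat) \<Longrightarrow> i < n \<Longrightarrow> a + r * i < r * n"
proof -
  assume "a < r" "i < n"
  then have "a + r * i < r * Suc i" by simp
  also have "\<dots> \<le> r * n" using \<open>i < n\<close> by (intro mult_le_mono) auto
  finally show ?thesis .
qed

lemma multi_index_linear_index:
  "ix \<in> indices ns \<Longrightarrow> linear_index ns ix < prod_list ns \<and> multi_index ns (linear_index ns ix) = ix"
proof (induction ns arbitrary: ix)
  case (Cons n ns)
  from Cons.prems obtain i jx where "ix = i # jx" "i < n" "jx \<in> indices ns"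
    by (auto simp: indices_Cons)
  then show ?case using Cons.IH[of jx] mixed_radix_less by simp
qed simp

lemma bij_betw_multi_index: "bij_betw (multi_index ns) {..<prod_list ns} (indices ns)"
  by (rule bij_betw_byWitness[where f' = "linear_index ns"])
    (auto simp: linear_index_multi_index multi_index_linear_index multi_index_in_indices)

lemma sum_multi_index: "(\<Sum>p<prod_list ns. f (multi_index ns p)) = (\<Sum>ix\<in>indices ns. f ix)"
  by (rule sum.reindex_bij_betw[OF bij_betw_multi_index])

text \<open>
  The position \<open>a + r i\<close> is the column-major position of the pair \<open>(a, i)\<close>, which is how the
  algorithm merges a rank index with a mode index.
\<close>

lemma sum_mixed_radix:
  fixes f :: "nat \<Rightarrow> 'a :: comm_monoid_add"
  shows "(\<Sum>p<r * n. f p) = (\<Sum>i<n. \<Sum>a<r. f (a + r * i))"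
proof (induction n)
  case (Suc n)
  have block: "(\<Sum>p<m + r. f p) = (\<Sum>p<m. f p) + (\<Sum>a<r. f (a + m))" for m
    by (induction r) (auto simp: ac_simps)
  have "r * Suc n = r * n + r" by simp
  then show ?case using Suc by (simp only: block sum.lessThan_Suc)
qed simp

lemma sqnorm_on_indices: "sqnorm_on (indices ns) X = (fnorm ns X)\<^sup>2"
  unfolding sqnorm_on_def fnorm_def by (simp add: sum_nonneg)

section \<open>Partial products of cores\<close>

fun left_product :: "nat list \<Rightarrow> (nat \<Rightarrow> tensor) \<Rightarrow> nat \<Rightarrow> nat list \<Rightarrow> nat \<Rightarrow> complex" where
  "left_product rs C 0 ix b = (if b = 0 then 1 else 0)"
| "left_product rs C (Suc k) ix b = (\<Sum>a<rs ! k. left_product rs C k ix a * C (Suc k) [a, ix ! k, b])"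

text \<open>
  The product of the last \<open>m\<close> slices, as a column. The recursion is on the number of factors because the
  product is built up from the last core.
\<close>

fun right_product :: "nat \<Rightarrow> nat list \<Rightarrow> (nat \<Rightarrow> tensor) \<Rightarrow> nat \<Rightarrow> nat list \<Rightarrow> nat \<Rightarrow> complex" where
  "right_product d rs C 0 ix a = (if a = 0 then 1 else 0)"
| "right_product d rs C (Suc m) ix a =
     (\<Sum>b<rs ! (d - m). C (d - m) [a, ix ! (d - Suc m), b] * right_product d rs C m ix b)"

lemma left_product_cong:
  "(\<And>j. j < k \<Longrightarrow> ix ! j = jx ! j) \<Longrightarrow> left_product rs C k ix b = left_product rs C k jx b"
  by (induction k arbitrary: b) auto

lemma right_product_cong:
  "m \<le> d \<Longrightarrow> (\<And>j. d - m \<le> j \<Longrightarrow> j < d \<Longrightarrow> ix ! j = jx ! j) \<Longrightarrow>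
    right_product d rs C m ix b = right_product d rs C m jx b"
  by (induction m arbitrary: b) auto

text \<open>
  Cutting the product of slices after the \<open>k\<close>-th core does not change its value: moving the cut by one
  place is associativity.
\<close>

lemma left_right_product:
  assumes "rs ! 0 = 1" and "k \<le> d"
  shows "(\<Sum>b<rs ! k. left_product rs C k ix b * right_product d rs C (d - k) ix b) =
    right_product d rs C d ix 0"
  using assms(2)
proof (induction k)
  case 0
  then show ?case using assms by simp
next
  case (Suc k)
  then have m: "d - k = Suc (d - Suc k)" "d - (d - Suc k) = Suc k" "d - Suc (d - Suc k) = k" by auto
  have "(\<Sum>b<rs ! Suc k. left_product rs C (Suc k) ix b * right_product d rs C (d - Suc k) ix b) =
      (\<Sum>a<rs ! k. left_product rs C k ix a * right_product d rs C (d - k) ix a)"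
    unfolding m(1) right_product.simps left_product.simps m(2,3)
    by (simp add: sum_distrib_left sum_distrib_right mult.assoc) (rule sum.swap)
  then show ?case using Suc by simp
qed

lemma foldr_core_slices:
  fixes C :: "nat \<Rightarrow> tensor" and ix :: "nat list"
  assumes rd: "rs ! d = 1" and m: "m \<le> d"
  defines "P \<equiv> \<lambda>k. foldr (*)
    (map (\<lambda>k. core_slice (rs ! (k - 1)) (rs ! k) (C k) (ix ! (k - 1))) [Suc k..<Suc d]) (1\<^sub>m 1)"
  shows "P (d - m) \<in> carrier_mat (rs ! (d - m)) 1 \<and>
    (\<forall>a<rs ! (d - m). P (d - m) $$ (a, 0) = right_product d rs C m ix a)"
  using m
proof (induction m)
  case 0
  then show ?case using rd by (simp add: P_def)
next
  case (Suc m)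
  define k where "k = d - Suc m"
  have k: "d - m = Suc k" "d - Suc m = k" "k < d" using Suc.prems by (auto simp: k_def)
  have up: "[Suc k..<Suc d] = Suc k # [Suc (Suc k)..<Suc d]" using k(3) by (simp add: upt_conv_Cons)
  have P: "P k = core_slice (rs ! k) (rs ! Suc k) (C (Suc k)) (ix ! k) * P (Suc k)"
    unfolding P_def up by simp
  have IH: "P (Suc k) \<in> carrier_mat (rs ! Suc k) 1"
    "\<And>b. b < rs ! Suc k \<Longrightarrow> P (Suc k) $$ (b, 0) = right_product d rs C m ix b"
    using Suc k by auto
  have "P k \<in> carrier_mat (rs ! k) 1" unfolding P using IH(1) by (auto simp: core_slice_def)
  moreover have "P k $$ (a, 0) = right_product d rs C (Suc m) ix a" if "a < rs ! k" for a
    unfolding P right_product.simps k using IH that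
    by (auto simp: core_slice_def scalar_prod_def atLeast0LessThan intro!: sum.cong)
  ultimately show ?case unfolding k by blast
qed

lemma tt_tensor_split:
  assumes "length ns = d" "rs ! 0 = 1" "rs ! d = 1" "ix \<in> indices ns" "k \<le> d"
  shows "tt_tensor ns rs C ix = (\<Sum>b<rs ! k. left_product rs C k ix b * right_product d rs C (d - k) ix b)"
  using foldr_core_slices[OF assms(3) order.refl, of C ix] assms left_right_product[of rs k d C ix]
  unfolding tt_tensor_def by simp

lemma tt_tensor_left_product:
  assumes "length ns = d" "rs ! 0 = 1" "rs ! d = 1" "ix \<in> indices ns"
  shows "tt_tensor ns rs C ix = left_product rs C d ix 0"
  using tt_tensor_split[OF assms order.refl, of C] assms by simp

lemma tt_tensor_in_tensors: "tt_tensor ns rs C \<in> tensors ns"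
  unfolding tensors_def tt_tensor_def by simp

section \<open>The error of TT-SVD\<close>

lemma reshape_entry:
  assumes T: "T \<in> carrier_mat r (n * N)" and "a < r" "i < n" "q < N"
  shows "reshape (r * n) N T $$ (a + r * i, q) = T $$ (a, i + n * q)"
proof -
  have lin: "a + r * i + r * n * q = a + r * (i + n * q)" by (simp add: algebra_simps)
  have "a + r * i < r * n" by (rule mixed_radix_less) fact+
  then have "reshape (r * n) N T $$ (a + r * i, q) =
      T $$ ((a + r * (i + n * q)) mod r, (a + r * (i + n * q)) div r)"
    using T assms unfolding reshape_def lin[symmetric] by simp
  also have "\<dots> = T $$ (a, i + n * q)" using assms by simp
  finally show ?thesis .
qed

lemma mat_to_core_entry:
  "a < r \<Longrightarrow> i < n \<Longrightarrow> b < r' \<Longrightarrow> mat_to_core r n r' M [a, i, b] = M $$ (a + r * i, b)"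
  unfolding mat_to_core_def by simp

text \<open>
  One run of the algorithm. Fixing the intermediate matrices \<open>T\<close> and the cores \<open>C\<close>, which
  \<open>ttsvd_output\<close> hides under an existential quantifier, allows statements about the single steps.
\<close>

locale ttsvd_run =
  fixes d :: nat and ns rs :: "nat list" and A :: tensor
    and T :: "nat \<Rightarrow> complex mat" and C :: "nat \<Rightarrow> tensor"
  assumes length_ns: "length ns = d" and d_pos: "1 \<le> d"
    and rs_0: "rs ! 0 = 1" and rs_d: "rs ! d = 1"
    and A: "A \<in> tensors ns"
    and T_0: "T 0 = unfolding_mat ns 0 A"
    and step: "\<And>k. 1 \<le> k \<Longrightarrow> k < d \<Longrightarrow> \<exists>U S V.
           truncated_svd (rs ! k)
             (reshape (rs ! (k - 1) * ns ! (k - 1)) (prod_list (drop k ns)) (T (k - 1))) U S V \<and>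
           C k = mat_to_core (rs ! (k - 1)) (ns ! (k - 1)) (rs ! k) U \<and>
           T k = S * mat_adjoint V"
    and last_core: "C d = mat_to_core (rs ! (d - 1)) (ns ! (d - 1)) 1
           (reshape (rs ! (d - 1) * ns ! (d - 1)) 1 (T (d - 1)))"
begin

text \<open>
  The contraction of the first \<open>k\<close> cores; column \<open>b\<close> of the matrix called \<open>W\<^sub>k\<close> in the introduction.
\<close>

abbreviation "W k ix b \<equiv> left_product rs C k ix b"

definition "tail_size k = prod_list (drop k ns)"

definition "energy k = (\<Sum>b<rs ! k. \<Sum>q<tail_size k. (cmod (T k $$ (b, q)))\<^sup>2)"

text \<open>
  The matrix of which step \<open>k + 1\<close> computes a truncated singular value decomposition.
\<close>

definition "step_matrix k = reshape (rs ! k * ns ! k) (tail_size (Suc k)) (T k)"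

lemma drop_ns: "k < d \<Longrightarrow> drop k ns = ns ! k # drop (Suc k) ns"
  using length_ns by (simp add: Cons_nth_drop_Suc)

lemma take_ns: "k < d \<Longrightarrow> take (Suc k) ns = take k ns @ [ns ! k]"
  using length_ns by (simp add: take_Suc_conv_app_nth)

lemma tail_size_Suc: "k < d \<Longrightarrow> tail_size k = ns ! k * tail_size (Suc k)"
  unfolding tail_size_def by (simp add: drop_ns)

lemma step_matrix_carrier: "step_matrix k \<in> carrier_mat (rs ! k * ns ! k) (tail_size (Suc k))"
  unfolding step_matrix_def reshape_def by simp

lemma stepE:
  assumes "Suc k < d"
  obtains U S V where "truncated_svd (rs ! Suc k) (step_matrix k) U S V"
    "C (Suc k) = mat_to_core (rs ! k) (ns ! k) (rs ! Suc k) U" "T (Suc k) = S * mat_adjoint V"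
  using step[of "Suc k"] assms unfolding step_matrix_def tail_size_def by auto

lemma T_carrier: "k < d \<Longrightarrow> T k \<in> carrier_mat (rs ! k) (tail_size k)"
proof (cases k)
  case 0
  then show ?thesis unfolding tail_size_def 0 T_0 unfolding_mat_def using rs_0 by simp
next
  case (Suc j)
  assume "k < d"
  then obtain U S V where "truncated_svd (rs ! Suc j) (step_matrix j) U S V" "T (Suc j) = S * mat_adjoint V"
    using stepE[of j] Suc by blast
  then show ?thesis using truncated_svd_coefficients(1)[OF _ step_matrix_carrier] Suc by metis
qed

lemma step_matrix_entry:
  "k < d \<Longrightarrow> a < rs ! k \<Longrightarrow> i < ns ! k \<Longrightarrow> q < tail_size (Suc k) \<Longrightarrow>
    step_matrix k $$ (a + rs ! k * i, q) = T k $$ (a, i + ns ! k * q)"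
  unfolding step_matrix_def using T_carrier[of k] by (intro reshape_entry) (auto simp: tail_size_Suc)

lemma left_product_snoc:
  assumes k: "Suc k < d" and U: "C (Suc k) = mat_to_core (rs ! k) (ns ! k) (rs ! Suc k) U"
    and "ix \<in> indices (take k ns)" "i < ns ! k" "b < rs ! Suc k"
  shows "W (Suc k) (ix @ i # jx) b = (\<Sum>a<rs ! k. U $$ (a + rs ! k * i, b) * W k ix a)"
proof -
  have len: "length ix = k" using assms length_in_indices length_ns by fastforce
  have "W k (ix @ i # jx) a = W k ix a" for a
    using len by (intro left_product_cong) (simp add: nth_append)
  then show ?thesis
    using assms len unfolding left_product.simps U
    by (intro sum.cong refl) (auto simp: nth_append mat_to_core_entry)
qed

text \<open>
  Each step multiplies the previous orthonormal family by the orthonormal columns of \<open>U\<close>, and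
  \<open>(W \<otimes> I) U\<close> is an isometry if \<open>W\<close> and \<open>U\<close> are.
\<close>

lemma left_products_orthonormal:
  "k < d \<Longrightarrow> a < rs ! k \<Longrightarrow> b < rs ! k \<Longrightarrow>
    inner_on (indices (take k ns)) (\<lambda>ix. W k ix a) (\<lambda>ix. W k ix b) = (if a = b then 1 else 0)"
proof (induction k arbitrary: a b)
  case 0
  then show ?case using rs_0 by (simp add: inner_on_def)
next
  case (Suc k)
  define I where "I = indices (take k ns)"
  define r where "r = rs ! k"
  obtain U S V where svd: "truncated_svd (rs ! Suc k) (step_matrix k) U S V"
    and U: "C (Suc k) = mat_to_core (rs ! k) (ns ! k) (rs ! Suc k) U"
    using stepE[OF Suc.prems(1)] by blast
  have IH: "inner_on I (\<lambda>ix. W k ix a) (\<lambda>ix. W k ix b) = (if a = b then 1 else 0)"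
    if "a < r" "b < r" for a b using Suc.IH that Suc.prems unfolding I_def r_def by auto
  have "inner_on (indices (take (Suc k) ns)) (\<lambda>ix. W (Suc k) ix a) (\<lambda>ix. W (Suc k) ix b) =
      (\<Sum>i<ns ! k. inner_on I (\<lambda>ix. W (Suc k) (ix @ [i]) a) (\<lambda>ix. W (Suc k) (ix @ [i]) b))"
    using Suc.prems(1) unfolding inner_on_def I_def
    by (simp add: take_ns sum_indices_append sum_indices_singleton del: left_product.simps)
      (rule sum.swap)
  also have "\<dots> = (\<Sum>i<ns ! k. inner_on I (\<lambda>ix. \<Sum>c<r. U $$ (c + r * i, a) * W k ix c)
       (\<lambda>ix. \<Sum>c<r. U $$ (c + r * i, b) * W k ix c))"
    using Suc.prems left_product_snoc[OF Suc.prems(1) U, of _ _ _ "[]"] unfolding I_def r_def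
    by (intro sum.cong inner_on_cong) (auto simp del: left_product.simps)
  also have "\<dots> = (\<Sum>i<ns ! k. \<Sum>c<r. cnj (U $$ (c + r * i, a)) * U $$ (c + r * i, b))"
  proof (intro sum.cong refl)
    fix i
    have "(\<Sum>e<r. U $$ (e + r * i, b) * inner_on I (\<lambda>ix. W k ix c) (\<lambda>ix. W k ix e)) =
        U $$ (c + r * i, b)" if c: "c < r" for c
    proof -
      have "(\<Sum>e<r. U $$ (e + r * i, b) * inner_on I (\<lambda>ix. W k ix c) (\<lambda>ix. W k ix e)) =
          (\<Sum>e<r. if e = c then U $$ (e + r * i, b) else 0)"
        using c by (intro sum.cong) (auto simp: IH)
      also have "\<dots> = U $$ (c + r * i, b)" using c by (subst sum.delta) auto
      finally show ?thesis .
    qed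
    then show "inner_on I (\<lambda>ix. \<Sum>c<r. U $$ (c + r * i, a) * W k ix c)
        (\<lambda>ix. \<Sum>c<r. U $$ (c + r * i, b) * W k ix c) =
        (\<Sum>c<r. cnj (U $$ (c + r * i, a)) * U $$ (c + r * i, b))"
      unfolding inner_on_sum_left inner_on_sum_right by simp
  qed
  also have "\<dots> = (\<Sum>p<r * ns ! k. cnj (U $$ (p, a)) * U $$ (p, b))"
    by (rule sum_mixed_radix[symmetric])
  also have "\<dots> = (if a = b then 1 else 0)"
    unfolding r_def by (rule truncated_svd_coefficients(2)[OF svd step_matrix_carrier]) (fact Suc.prems)+
  finally show ?case .
qed

lemma left_products_orthogonal_family:
  "k < d \<Longrightarrow> orthogonal_family (indices (take k ns)) (rs ! k) (\<lambda>b ix. W k ix b)"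
proof -
  assume k: "k < d"
  have "sqnorm_on (indices (take k ns)) (\<lambda>ix. W k ix a) = 1" if "a < rs ! k" for a
    using left_products_orthonormal[OF k that that] by (simp add: inner_on_self)
  then show ?thesis
    unfolding orthogonal_family_def using left_products_orthonormal[OF k] by auto
qed

lemma multi_index_drop:
  assumes "k < d" "i < ns ! k"
  shows "multi_index (drop k ns) (i + ns ! k * q) = i # multi_index (drop (Suc k) ns) q"
  using assms by (simp add: drop_ns)

text \<open>
  \<open>T\<^sub>k = W\<^sub>k\<^sup>* A\<close>, unfolded at \<open>k\<close>: both sides satisfy the same recursion, since a step multiplies the
  reshaped \<open>T\<^sub>k\<close> by \<open>U\<^sup>*\<close>.
\<close>

lemma T_entry:
  "k < d \<Longrightarrow> b < rs ! k \<Longrightarrow> q < tail_size k \<Longrightarrow> T k $$ (b, q) =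
    inner_on (indices (take k ns)) (\<lambda>ix. W k ix b) (\<lambda>ix. A (ix @ multi_index (drop k ns) q))"
proof (induction k arbitrary: b q)
  case 0
  then show ?case using rs_0
    unfolding T_0 unfolding_mat_def tail_size_def by (simp add: inner_on_def)
next
  case (Suc k)
  define I where "I = indices (take k ns)"
  define r where "r = rs ! k"
  obtain U S V where svd: "truncated_svd (rs ! Suc k) (step_matrix k) U S V"
    and U: "C (Suc k) = mat_to_core (rs ! k) (ns ! k) (rs ! Suc k) U"
    and T: "T (Suc k) = S * mat_adjoint V"
    using stepE[OF Suc.prems(1)] by blast
  have "T (Suc k) $$ (b, q) = (\<Sum>p<r * ns ! k. cnj (U $$ (p, b)) * step_matrix k $$ (p, q))"
    unfolding T r_def by (rule truncated_svd_coefficients(3)[OF svd step_matrix_carrier]) (fact Suc.prems)+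
  also have "\<dots> = (\<Sum>i<ns ! k. \<Sum>a<r. cnj (U $$ (a + r * i, b)) * step_matrix k $$ (a + r * i, q))"
    by (rule sum_mixed_radix)
  also have "\<dots> = (\<Sum>i<ns ! k. \<Sum>a<r. cnj (U $$ (a + r * i, b)) *
      inner_on I (\<lambda>ix. W k ix a) (\<lambda>ix. A (ix @ i # multi_index (drop (Suc k) ns) q)))"
  proof (intro sum.cong refl)
    fix i a assume "i \<in> {..<ns ! k}" "a \<in> {..<r}"
    then have ia: "i < ns ! k" "a < rs ! k" by (auto simp: r_def)
    have "i + ns ! k * q < tail_size k"
      using mixed_radix_less[OF ia(1) Suc.prems(3)] tail_size_Suc[of k] Suc.prems by simp
    then show "cnj (U $$ (a + r * i, b)) * step_matrix k $$ (a + r * i, q) = cnj (U $$ (a + r * i, b)) *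
        inner_on I (\<lambda>ix. W k ix a) (\<lambda>ix. A (ix @ i # multi_index (drop (Suc k) ns) q))"
      using Suc.IH[of a "i + ns ! k * q"] Suc.prems ia step_matrix_entry[of k a i q]
      unfolding r_def I_def by (simp add: multi_index_drop)
  qed
  also have "\<dots> = (\<Sum>i<ns ! k. inner_on I (\<lambda>ix. W (Suc k) (ix @ [i]) b)
      (\<lambda>ix. A (ix @ i # multi_index (drop (Suc k) ns) q)))"
    unfolding inner_on_sum_left[symmetric]
    using Suc.prems left_product_snoc[OF Suc.prems(1) U, of _ _ _ "[]"] unfolding I_def r_def
    by (intro sum.cong inner_on_cong) (auto simp del: left_product.simps)
  also have "\<dots> = inner_on (indices (take (Suc k) ns)) (\<lambda>ix. W (Suc k) ix b)
      (\<lambda>ix. A (ix @ multi_index (drop (Suc k) ns) q))"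
    using Suc.prems(1) unfolding inner_on_def I_def
    by (simp add: take_ns sum_indices_append sum_indices_singleton del: left_product.simps)
      (rule sum.swap)
  finally show ?case .
qed

lemma sum_indices_columns:
  "(\<Sum>q<tail_size k. \<Sum>ix\<in>indices (take k ns). f (ix @ multi_index (drop k ns) q)) = (\<Sum>ix\<in>indices ns. f ix)"
  unfolding tail_size_def sum_multi_index[of "\<lambda>jx. \<Sum>ix\<in>indices (take k ns). f (ix @ jx)"]
  by (subst sum.swap) (rule sum_indices_take_drop[symmetric])

lemma energy_step_matrix:
  "k < d \<Longrightarrow> (\<Sum>p<rs ! k * ns ! k. \<Sum>q<tail_size (Suc k). (cmod (step_matrix k $$ (p, q)))\<^sup>2) = energy k"
proof -
  assume k: "k < d"
  have "(\<Sum>p<rs ! k * ns ! k. \<Sum>q<tail_size (Suc k). (cmod (step_matrix k $$ (p, q)))\<^sup>2) =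
      (\<Sum>i<ns ! k. \<Sum>a<rs ! k. \<Sum>q<tail_size (Suc k). (cmod (T k $$ (a, i + ns ! k * q)))\<^sup>2)"
    unfolding sum_mixed_radix using step_matrix_entry[OF k] by (intro sum.cong) auto
  also have "\<dots> = (\<Sum>a<rs ! k. \<Sum>q<tail_size (Suc k). \<Sum>i<ns ! k. (cmod (T k $$ (a, i + ns ! k * q)))\<^sup>2)"
    by (subst sum.swap) (intro sum.cong refl sum.swap)
  also have "\<dots> = energy k"
    unfolding energy_def tail_size_Suc[OF k] sum_mixed_radix ..
  finally show ?thesis .
qed

lemma energy_0: "energy 0 = (fnorm ns A)\<^sup>2"
proof -
  have "energy 0 = (\<Sum>q<tail_size 0. \<Sum>ix\<in>indices (take 0 ns). (cmod (A (ix @ multi_index (drop 0 ns) q)))\<^sup>2)"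
    unfolding energy_def using T_entry[of 0 0] d_pos rs_0 by (simp add: inner_on_def)
  also have "\<dots> = (fnorm ns A)\<^sup>2"
    unfolding sqnorm_on_indices[symmetric] sqnorm_on_def
    by (rule sum_indices_columns[of "\<lambda>ix. (cmod (A ix))\<^sup>2"])
  finally show ?thesis .
qed

text \<open>
  The loss of energy in one step is the squared error of a truncated singular value decomposition. The
  competitor for Eckart-Young is \<open>X\<close> contracted with \<open>W\<^sub>k\<close> on the first \<open>k\<close> modes: it inherits the
  factorization of \<open>X\<close> at \<open>k + 1\<close>, hence has rank at most \<open>r\<^sub>k\<^sub>+\<^sub>1\<close>, and its distance to \<open>W\<^sub>k\<^sup>* A\<close> is at
  most \<open>\<parallel>X - A\<parallel>\<close> by Bessel.
\<close>

lemma energy_drop_le: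
  assumes k: "Suc k < d"
    and X: "\<And>ix jx. ix \<in> indices (take (Suc k) ns) \<Longrightarrow> jx \<in> indices (drop (Suc k) ns) \<Longrightarrow>
      X (ix @ jx) = (\<Sum>b<rs ! Suc k. F ix b * G b jx)"
  shows "energy k - energy (Suc k) \<le> (fnorm ns (X - A))\<^sup>2"
proof -
  define I where "I = indices (take k ns)"
  define r where "r = rs ! k"
  define n where "n = ns ! k"
  define mi where "mi = multi_index (drop k ns)"
  define mi' where "mi' = multi_index (drop (Suc k) ns)"
  have k': "k < d" using k by simp
  obtain U S V where svd: "truncated_svd (rs ! Suc k) (step_matrix k) U S V"
    and T: "T (Suc k) = S * mat_adjoint V"
    using stepE[OF k] by blast
  \<comment> \<open>\<open>F'\<close> and \<open>G'\<close> are the factors of the contracted \<open>X\<close>; the row \<open>p\<close> stands for the pair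
    of the rank index \<open>p mod r\<close> and the mode index \<open>p div r\<close>.\<close>
  define F' where "F' = (\<lambda>p b. inner_on I (\<lambda>ix. W k ix (p mod r)) (\<lambda>ix. F (ix @ [p div r]) b))"
  define G' where "G' = (\<lambda>b q. G b (mi' q))"
  have entry: "step_matrix k $$ (a + r * i, q) - (\<Sum>b<rs ! Suc k. F' (a + r * i) b * G' b q) =
      inner_on I (\<lambda>ix. W k ix a) (\<lambda>ix. A (ix @ mi (i + n * q)) - X (ix @ mi (i + n * q)))"
    if a: "a < r" and i: "i < n" and q: "q < tail_size (Suc k)" for a i q
  proof -
    have mi: "mi (i + n * q) = i # mi' q"
      unfolding mi_def mi'_def n_def by (rule multi_index_drop[OF k' i[unfolded n_def]])
    have "i + n * q < tail_size k" using mixed_radix_less[OF i q] tail_size_Suc[OF k'] unfolding n_def by simp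
    then have M: "step_matrix k $$ (a + r * i, q) = inner_on I (\<lambda>ix. W k ix a) (\<lambda>ix. A (ix @ mi (i + n * q)))"
      using step_matrix_entry[OF k'] T_entry[OF k'] a i q unfolding r_def n_def I_def mi_def by simp
    have jx: "mi' q \<in> indices (drop (Suc k) ns)"
      using q unfolding mi'_def tail_size_def by (rule multi_index_in_indices)
    have Xi: "X (ix @ i # mi' q) = (\<Sum>b<rs ! Suc k. G b (mi' q) * F (ix @ [i]) b)" if "ix \<in> I" for ix
    proof -
      have "ix @ [i] \<in> indices (take (Suc k) ns)"
        using that i k' length_ns length_in_indices[of ix "take k ns"]
        by (simp add: take_ns I_def n_def)
      then show ?thesis using X[of "ix @ [i]", OF _ jx] by (simp add: mult.commute)
    qed
    have "inner_on I (\<lambda>ix. W k ix a) (\<lambda>ix. X (ix @ mi (i + n * q))) =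
        inner_on I (\<lambda>ix. W k ix a) (\<lambda>ix. \<Sum>b<rs ! Suc k. G b (mi' q) * F (ix @ [i]) b)"
      by (intro inner_on_cong) (auto simp: mi Xi)
    also have "\<dots> = (\<Sum>b<rs ! Suc k. F' (a + r * i) b * G' b q)"
      unfolding inner_on_sum_right F'_def G'_def using a by (simp add: mult.commute)
    finally show ?thesis by (simp add: M inner_on_diff_right)
  qed
  have "energy k - energy (Suc k) \<le> (\<Sum>p<r * n. \<Sum>q<tail_size (Suc k).
      (cmod (step_matrix k $$ (p, q) - (\<Sum>b<rs ! Suc k. F' p b * G' b q)))\<^sup>2)"
    using truncated_svd_optimal[OF svd step_matrix_carrier, of F' G'] energy_step_matrix[OF k']
    unfolding r_def n_def energy_def[of "Suc k"] T by simp
  also have "\<dots> = (\<Sum>i<n. \<Sum>a<r. \<Sum>q<tail_size (Suc k). (cmod (inner_on I (\<lambda>ix. W k ix a)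
      (\<lambda>ix. A (ix @ mi (i + n * q)) - X (ix @ mi (i + n * q)))))\<^sup>2)"
    unfolding sum_mixed_radix by (intro sum.cong refl) (simp add: entry)
  also have "\<dots> = (\<Sum>q<tail_size (Suc k). \<Sum>i<n. \<Sum>a<r. (cmod (inner_on I (\<lambda>ix. W k ix a)
      (\<lambda>ix. A (ix @ mi (i + n * q)) - X (ix @ mi (i + n * q)))))\<^sup>2)"
    by (rule trans[OF sum.cong[OF refl sum.swap] sum.swap])
  also have "\<dots> = (\<Sum>q<tail_size k. \<Sum>a<r. (cmod (inner_on I (\<lambda>ix. W k ix a)
      (\<lambda>ix. A (ix @ mi q) - X (ix @ mi q))))\<^sup>2)"
    unfolding tail_size_Suc[OF k'] sum_mixed_radix n_def ..
  also have "\<dots> \<le> (\<Sum>q<tail_size k. sqnorm_on I (\<lambda>ix. A (ix @ mi q) - X (ix @ mi q)))"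
    using left_products_orthogonal_family[OF k'] unfolding r_def I_def
    by (intro sum_mono bessel_inequality) auto
  also have "\<dots> = sqnorm_on (indices ns) (\<lambda>ix. A ix - X ix)"
    unfolding sqnorm_on_def I_def mi_def
    by (rule sum_indices_columns[of "\<lambda>ix. (cmod (A ix - X ix))\<^sup>2"])
  also have "\<dots> = (fnorm ns (X - A))\<^sup>2"
    unfolding sqnorm_on_indices[symmetric] sqnorm_on_def by (simp add: norm_minus_commute)
  finally show ?thesis .
qed

text \<open>
  Reshaping \<open>T\<close> at stage \<open>d - 1\<close> into the last core makes the output equal to \<open>W W\<^sup>* A\<close> at that stage,
  the orthogonal projection of the columns of \<open>A\<close>, so Pythagoras gives the error.
\<close>

lemma ttsvd_error: "(fnorm ns (tt_tensor ns rs C - A))\<^sup>2 = (fnorm ns A)\<^sup>2 - energy (d - 1)"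
proof -
  define k where "k = d - 1"
  define I where "I = indices (take k ns)"
  have k: "k < d" "Suc k = d" using d_pos by (auto simp: k_def)
  have dk: "drop k ns = [ns ! k]" using drop_ns[OF k(1)] k length_ns by simp
  have Nk: "tail_size k = ns ! k" unfolding tail_size_def dk by simp
  have mi: "multi_index (drop k ns) q = [q]" if "q < tail_size k" for q
    using that unfolding dk Nk by simp
  have Y: "tt_tensor ns rs C (ix @ [i]) = (\<Sum>a<rs ! k. T k $$ (a, i) * W k ix a)"
    if ix: "ix \<in> I" and i: "i < tail_size k" for ix i
  proof -
    have len: "length ix = k" using ix length_ns k length_in_indices[of ix "take k ns"] by (simp add: I_def)
    have "ix @ [i] \<in> indices ns"
    proof -
      have "ns = take k ns @ [ns ! k]" using take_ns[OF k(1)] k length_ns by simp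
      then show ?thesis
        using append_in_indices[of ix "take k ns" "[i]" "[ns ! k]"] ix i len k length_ns
        unfolding I_def Nk by simp
    qed
    then have "tt_tensor ns rs C (ix @ [i]) = left_product rs C (Suc k) (ix @ [i]) 0"
      unfolding k(2) by (intro tt_tensor_left_product length_ns rs_0 rs_d)
    also have "\<dots> = (\<Sum>a<rs ! k. W k (ix @ [i]) a * C d [a, i, 0])"
      using len by (subst left_product.simps) (simp add: k nth_append)
    also have "\<dots> = (\<Sum>a<rs ! k. T k $$ (a, i) * W k ix a)"
    proof (intro sum.cong refl)
      fix a assume a: "a \<in> {..<rs ! k}"
      have "W k (ix @ [i]) a = W k ix a"
        using len by (intro left_product_cong) (simp add: nth_append)
      moreover have "C d [a, i, 0] = T k $$ (a, i)"
        using a i reshape_entry[of "T k" "rs ! k" "ns ! k" 1 a i 0] T_carrier[OF k(1)]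
        unfolding last_core k_def[symmetric] Nk by (simp add: mat_to_core_entry)
      ultimately show "W k (ix @ [i]) a * C d [a, i, 0] = T k $$ (a, i) * W k ix a"
        by (simp add: mult.commute)
    qed
    finally show ?thesis .
  qed
  have col: "sqnorm_on I (\<lambda>ix. (tt_tensor ns rs C - A) (ix @ multi_index (drop k ns) q)) =
      sqnorm_on I (\<lambda>ix. A (ix @ multi_index (drop k ns) q)) - (\<Sum>a<rs ! k. (cmod (T k $$ (a, q)))\<^sup>2)"
    if q: "q < tail_size k" for q
  proof -
    define x where "x = (\<lambda>ix. A (ix @ multi_index (drop k ns) q))"
    have Tx: "T k $$ (a, q) = inner_on I (\<lambda>ix. W k ix a) x" if "a < rs ! k" for a
      using T_entry[OF k(1) that q] unfolding x_def I_def .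
    have "sqnorm_on I (\<lambda>ix. (tt_tensor ns rs C - A) (ix @ multi_index (drop k ns) q)) =
        sqnorm_on I (\<lambda>ix. x ix - (\<Sum>a<rs ! k. inner_on I (\<lambda>ix. W k ix a) x * W k ix a))"
      unfolding sqnorm_on_def
      by (intro sum.cong refl) (simp add: mi[OF q] x_def[symmetric] Y[OF _ q] Tx norm_minus_commute x_def)
    also have "\<dots> = sqnorm_on I x - (\<Sum>a<rs ! k. (cmod (inner_on I (\<lambda>ix. W k ix a) x))\<^sup>2)"
      using left_products_orthogonal_family[OF k(1)] unfolding I_def by (intro sqnorm_residual) auto
    finally show ?thesis unfolding x_def[symmetric] by (simp add: Tx)
  qed
  have columns: "(fnorm ns Z)\<^sup>2 = (\<Sum>q<tail_size k. sqnorm_on I (\<lambda>ix. Z (ix @ multi_index (drop k ns) q)))" for Z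
    unfolding sqnorm_on_indices[symmetric] sqnorm_on_def I_def
    by (rule sum_indices_columns[of _ k, symmetric])
  have "(\<Sum>q<tail_size k. \<Sum>a<rs ! k. (cmod (T k $$ (a, q)))\<^sup>2) = energy k"
    unfolding energy_def by (rule sum.swap)
  moreover have "(fnorm ns (tt_tensor ns rs C - A))\<^sup>2 =
      (\<Sum>q<tail_size k. sqnorm_on I (\<lambda>ix. A (ix @ multi_index (drop k ns) q)) - (\<Sum>a<rs ! k. (cmod (T k $$ (a, q)))\<^sup>2))"
    unfolding columns by (intro sum.cong refl, rule col) simp
  ultimately show ?thesis
    unfolding columns[of A] k_def[symmetric] by (simp only: sum_subtractf)
qed

lemma ttsvd_quasi_optimal:
  assumes X: "\<And>k. 1 \<le> k \<Longrightarrow> k < d \<Longrightarrow> \<exists>F G. \<forall>ix\<in>indices (take k ns). \<forall>jx\<in>indices (drop k ns).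
      X (ix @ jx) = (\<Sum>b<rs ! k. F ix b * G b jx)"
  shows "fnorm ns (tt_tensor ns rs C - A) \<le> sqrt (real (d - 1)) * fnorm ns (X - A)"
proof -
  define \<delta> where "\<delta> = (fnorm ns (X - A))\<^sup>2"
  have bound: "energy 0 - energy k \<le> real k * \<delta>" if "k < d" for k
    using that
  proof (induction k)
    case (Suc k)
    obtain F G where "\<forall>ix\<in>indices (take (Suc k) ns). \<forall>jx\<in>indices (drop (Suc k) ns).
        X (ix @ jx) = (\<Sum>b<rs ! Suc k. F ix b * G b jx)"
      using X[of "Suc k"] Suc.prems by auto
    then have "energy k - energy (Suc k) \<le> \<delta>"
      unfolding \<delta>_def by (intro energy_drop_le[OF Suc.prems, of X F G]) auto
    then show ?case using Suc by (simp add: algebra_simps)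
  qed simp
  then have "(fnorm ns (tt_tensor ns rs C - A))\<^sup>2 \<le> real (d - 1) * \<delta>"
    using bound[of "d - 1"] ttsvd_error energy_0 d_pos by simp
  then have "sqrt ((fnorm ns (tt_tensor ns rs C - A))\<^sup>2) \<le> sqrt (real (d - 1) * \<delta>)"
    by (rule real_sqrt_le_mono)
  then show ?thesis unfolding \<delta>_def by (simp add: real_sqrt_mult fnorm_def sum_nonneg)
qed

text \<open>
  A zero output has lost all energy. But a truncated singular value decomposition that keeps at least
  one triplet annihilates only the zero matrix, so going back through the steps no energy was there to
  begin with.
\<close>

lemma ttsvd_zero_imp_zero:
  assumes pos: "\<And>k. 1 \<le> k \<Longrightarrow> k < d \<Longrightarrow> 1 \<le> rs ! k"
    and zero: "tt_tensor ns rs C = (\<lambda>_. 0)"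
  shows "A = (\<lambda>_. 0)"
proof -
  have step0: "energy k = 0" if k: "Suc k < d" and "energy (Suc k) = 0" for k
  proof -
    obtain U S V where svd: "truncated_svd (rs ! Suc k) (step_matrix k) U S V" and T: "T (Suc k) = S * mat_adjoint V"
      using stepE[OF k] by blast
    have "T (Suc k) $$ (b, q) = 0" if "b < rs ! Suc k" "q < tail_size (Suc k)" for b q
    proof -
      have "(\<Sum>q<tail_size (Suc k). (cmod (T (Suc k) $$ (b, q)))\<^sup>2) = 0"
        using \<open>energy (Suc k) = 0\<close> that unfolding energy_def
        by (subst (asm) sum_nonneg_eq_0_iff) (auto simp: sum_nonneg)
      then show ?thesis using that by (subst (asm) sum_nonneg_eq_0_iff) auto
    qed
    then have "step_matrix k $$ (p, q) = 0" if "p < rs ! k * ns ! k" "q < tail_size (Suc k)" for p q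
      using truncated_svd_zero[OF svd step_matrix_carrier _ _ that] pos[of "Suc k"] k T by auto
    then show ?thesis using energy_step_matrix[of k] k by simp
  qed
  have "(fnorm ns (tt_tensor ns rs C - A))\<^sup>2 = (fnorm ns A)\<^sup>2"
    unfolding zero fnorm_def by simp
  then have last: "energy (d - 1) = 0" using ttsvd_error by simp
  have "energy 0 = 0"
    by (rule inc_induct[of 0 "d - 1"]) (use last step0 d_pos in auto)
  then have "sqnorm_on (indices ns) A = 0" unfolding energy_0 sqnorm_on_indices .
  then show ?thesis using A by (auto simp: sqnorm_on_zero_iff tensors_def)
qed

end

section \<open>Tensors of prescribed TT rank\<close>

lemma unfolding_mat_carrier [simp]:
  "unfolding_mat ns k X \<in> carrier_mat (prod_list (take k ns)) (prod_list (drop k ns))"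
  unfolding unfolding_mat_def by simp

lemma unfolding_mat_entry:
  assumes "ix \<in> indices (take k ns)" "jx \<in> indices (drop k ns)"
  shows "unfolding_mat ns k X $$ (linear_index (take k ns) ix, linear_index (drop k ns) jx) = X (ix @ jx)"
  using multi_index_linear_index[OF assms(1)] multi_index_linear_index[OF assms(2)]
  unfolding unfolding_mat_def by simp

text \<open>
  The right factor consists of combinations of the rows of the unfolding itself; this is what makes
  the factorizations for different \<open>k\<close> fit together to a TT decomposition.
\<close>

lemma unfolding_rank_factorization:
  assumes r: "mat_rank (unfolding_mat ns k X) = r"
  shows "\<exists>F L. \<forall>ix\<in>indices (take k ns). \<forall>jx\<in>indices (drop k ns).
    X (ix @ jx) = (\<Sum>b<r. F ix b * (\<Sum>y\<in>indices (take k ns). L b y * X (y @ jx)))"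
proof -
  define M where "M = unfolding_mat ns k X"
  define m where "m = prod_list (take k ns)"
  define n where "n = prod_list (drop k ns)"
  let ?li = "linear_index (take k ns)"
  have M: "M \<in> carrier_mat m n" unfolding M_def m_def n_def by simp
  obtain L R where L: "L \<in> carrier_mat r m" and R: "R \<in> carrier_mat n r"
    and eq: "(M * R) * (L * M) = M"
    using mat_rank_factorization[OF M] r unfolding M_def[symmetric] by metis
  have factorized: "X (ix @ jx) = (\<Sum>b<r. (M * R) $$ (?li ix, b) * (\<Sum>y\<in>indices (take k ns). L $$ (b, ?li y) * X (y @ jx)))"
    if ix: "ix \<in> indices (take k ns)" and jx: "jx \<in> indices (drop k ns)" for ix jx
  proof -
    define q where "q = linear_index (drop k ns) jx"
    have q: "q < n" and p: "?li ix < m"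
      using multi_index_linear_index[OF jx] multi_index_linear_index[OF ix] by (auto simp: q_def n_def m_def)
    have LM: "(L * M) $$ (b, q) = (\<Sum>y\<in>indices (take k ns). L $$ (b, ?li y) * X (y @ jx))" if "b < r" for b
    proof -
      have "(L * M) $$ (b, q) = (\<Sum>p<m. L $$ (b, p) * M $$ (p, q))"
        using L M q that by (auto simp: scalar_prod_def atLeast0LessThan intro!: sum.cong)
      also have "\<dots> = (\<Sum>p<m. L $$ (b, ?li (multi_index (take k ns) p)) *
          M $$ (?li (multi_index (take k ns) p), q))"
        by (intro sum.cong) (auto simp: linear_index_multi_index m_def)
      also have "\<dots> = (\<Sum>y\<in>indices (take k ns). L $$ (b, ?li y) * M $$ (?li y, q))"
        unfolding m_def by (rule sum_multi_index)
      also have "\<dots> = (\<Sum>y\<in>indices (take k ns). L $$ (b, ?li y) * X (y @ jx))"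
        unfolding M_def q_def using jx by (intro sum.cong) (auto simp: unfolding_mat_entry)
      finally show ?thesis .
    qed
    have "X (ix @ jx) = ((M * R) * (L * M)) $$ (?li ix, q)"
      unfolding eq unfolding M_def q_def by (rule unfolding_mat_entry[symmetric]) fact+
    also have "\<dots> = (\<Sum>b<r. (M * R) $$ (?li ix, b) * (L * M) $$ (b, q))"
      using mult_mat_entry[OF mult_carrier_mat[OF M R] mult_carrier_mat[OF L M] p q] .
    finally show ?thesis using LM by simp
  qed
  show ?thesis
    by (intro exI[of _ "\<lambda>ix b. (M * R) $$ (?li ix, b)"] exI[of _ "\<lambda>b y. L $$ (b, ?li y)"] ballI)
      (rule factorized)
qed

lemma tt_rank_eqI:
  assumes "length ns = d" "1 \<le> d" "length rs = d + 1" "rs ! 0 = 1" "rs ! d = 1"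
    and "\<And>k. 1 \<le> k \<Longrightarrow> k < d \<Longrightarrow> mat_rank (unfolding_mat ns k X) = rs ! k"
  shows "tt_rank ns X = rs"
proof (rule nth_equalityI)
  fix k assume "k < length (tt_rank ns X)"
  then have "k \<le> d" using assms by (simp add: tt_rank_def)
  then show "tt_rank ns X ! k = rs ! k"
  proof (cases "1 \<le> k \<and> k < d")
    case True
    then show ?thesis using assms by (cases k) (auto simp: tt_rank_def nth_append)
  next
    case False
    then have "k = 0 \<or> k = d" using \<open>k \<le> d\<close> by auto
    then show ?thesis using assms by (auto simp: tt_rank_def nth_append nth_Cons')
  qed
qed (use assms in \<open>simp add: tt_rank_def\<close>)

lemma tt_rank_nth:
  assumes "tt_rank ns X = rs" "1 \<le> k" "k < length ns"
  shows "mat_rank (unfolding_mat ns k X) = rs ! k"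
  using assms(2,3) unfolding assms(1)[symmetric] tt_rank_def
  by (cases k) (auto simp: nth_append)

text \<open>
  Let \<open>g\<^sub>k\<close> be the right factor of the unfolding at \<open>k\<close>. Fixing the first mode of a vector of \<open>g\<^sub>k\<close>
  gives a combination of rows of the unfolding at \<open>k + 1\<close>, hence of the vectors of \<open>g\<^sub>k\<^sub>+\<^sub>1\<close>. The
  coefficients form core \<open>k + 1\<close>, and the products of the last cores reproduce the \<open>g\<^sub>k\<close>.
\<close>

lemma exact_tt_decomposition:
  assumes len: "length ns = d" and d: "1 \<le> d" and r0: "rs ! 0 = 1" and rd: "rs ! d = 1"
    and X: "X \<in> tensors ns" and rank: "tt_rank ns X = rs"
  shows "\<exists>D. X = tt_tensor ns rs D"
proof -
  define factorizes where "factorizes = (\<lambda>k F L. \<forall>ix\<in>indices (take k ns). \<forall>jx\<in>indices (drop k ns).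
      X (ix @ jx) = (\<Sum>b<rs ! k. F ix b * (\<Sum>y\<in>indices (take k ns). L b y * X (y @ jx))))"
  have "\<exists>F L. factorizes k F L" if "1 \<le> k" "k < d" for k
    using tt_rank_nth[OF rank that(1)] that len unfolding factorizes_def
    by (intro unfolding_rank_factorization) simp
  then obtain F0 L0 where FL: "\<And>k. 1 \<le> k \<Longrightarrow> k < d \<Longrightarrow> factorizes k (F0 k) (L0 k)"
    by metis
  \<comment> \<open>At the ends the factorizations are the trivial ones: \<open>X = 1 \<cdot> X\<close> for \<open>k = 0\<close>, and
    \<open>X = X \<cdot> 1\<close> for \<open>k = d\<close>.\<close>
  define F where "F = (\<lambda>k ix b. if k = d then X ix else F0 k ix b)"
  define L where "L = (\<lambda>k b y. if k = 0 then 1 else L0 k b y)"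
  define g where "g = (\<lambda>k b jx. if k = d then 1 else \<Sum>y\<in>indices (take k ns). L k b y * X (y @ jx))"
  \<comment> \<open>The list \<open>l\<close> is a core index \<open>[a, i, b]\<close>.\<close>
  define D :: "nat \<Rightarrow> tensor" where "D = (\<lambda>k l. \<Sum>y\<in>indices (take (k - 1) ns).
      L (k - 1) (l ! 0) y * F k (y @ [l ! 1]) (l ! 2))"
  have factor: "X (y @ jx) = (\<Sum>b<rs ! k. F k y b * g k b jx)"
    if k: "1 \<le> k" "k \<le> d" and y: "y \<in> indices (take k ns)" "jx \<in> indices (drop k ns)" for k y jx
  proof (cases "k = d")
    case True
    then have "jx = []" using y(2) len by simp
    then show ?thesis using True rd by (simp add: F_def g_def)
  next
    case False
    then have "X (y @ jx) =
        (\<Sum>b<rs ! k. F0 k y b * (\<Sum>z\<in>indices (take k ns). L0 k b z * X (z @ jx)))"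
      using FL[OF k(1)] k(2) y unfolding factorizes_def by (simp only: nat_less_le) blast
    also have "\<dots> = (\<Sum>b<rs ! k. F k y b * g k b jx)"
      using False k by (simp add: F_def g_def L_def)
    finally show ?thesis .
  qed
  have tails: "right_product d rs D m ix a = g (d - m) a (drop (d - m) ix)"
    if m: "m \<le> d" and ix: "ix \<in> indices ns" and a: "a < rs ! (d - m)" for m ix a
    using m a
  proof (induction m arbitrary: a)
    case 0
    then show ?case using rd by (simp add: g_def)
  next
    case (Suc m)
    define k where "k = d - Suc m"
    have k: "d - m = Suc k" "d - Suc m = k" "k < d" using Suc.prems by (auto simp: k_def)
    have lx: "length ix = d" using length_in_indices[OF ix] len by simp
    have split: "ns = take k ns @ [ns ! k] @ drop (Suc k) ns"
      using k len id_take_nth_drop[of k ns] by simp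
    have "ix = take k ix @ [ix ! k] @ drop (Suc k) ix"
      using k lx id_take_nth_drop[of k ix] by simp
    then have "take k ix @ [ix ! k] @ drop (Suc k) ix \<in> indices (take k ns @ [ns ! k] @ drop (Suc k) ns)"
      using ix split by metis
    then have parts: "ix ! k < ns ! k" "drop (Suc k) ix \<in> indices (drop (Suc k) ns)"
      using lx len by auto
    have y: "y @ [ix ! k] \<in> indices (take (Suc k) ns)" if "y \<in> indices (take k ns)" for y
      using that k len parts(1) length_in_indices[OF that] by (simp add: take_Suc_conv_app_nth)
    have "right_product d rs D (Suc m) ix a =
        (\<Sum>b<rs ! Suc k. D (Suc k) [a, ix ! k, b] * g (Suc k) b (drop (Suc k) ix))"
      using Suc k by simp
    also have "\<dots> = (\<Sum>b<rs ! Suc k. \<Sum>y\<in>indices (take k ns).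
        L k a y * (F (Suc k) (y @ [ix ! k]) b * g (Suc k) b (drop (Suc k) ix)))"
      by (simp add: D_def sum_distrib_right mult.assoc)
    also have "\<dots> = (\<Sum>y\<in>indices (take k ns). L k a y *
        (\<Sum>b<rs ! Suc k. F (Suc k) (y @ [ix ! k]) b * g (Suc k) b (drop (Suc k) ix)))"
      by (subst sum.swap) (simp add: sum_distrib_left)
    also have "\<dots> = (\<Sum>y\<in>indices (take k ns). L k a y * X ((y @ [ix ! k]) @ drop (Suc k) ix))"
      using k by (intro sum.cong refl arg_cong2[of _ _ _ _ "(*)"] factor[symmetric] y parts) auto
    also have "\<dots> = g k a (drop k ix)"
      using k lx by (simp add: g_def Cons_nth_drop_Suc)
    finally show ?case unfolding k .
  qed
  have "X ix = tt_tensor ns rs D ix" for ix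
  proof (cases "ix \<in> indices ns")
    case True
    have "tt_tensor ns rs D ix = right_product d rs D d ix 0"
      using tt_tensor_split[OF len r0 rd True, of 0 D] r0 by simp
    also have "\<dots> = X ix" using tails[OF _ True, of d 0] r0 d by (simp add: g_def L_def)
    finally show ?thesis by simp
  next
    case False
    then show ?thesis using X by (simp add: tensors_def tt_tensor_def)
  qed
  then show ?thesis by blast
qed

lemma mat_rank_smult_le:
  assumes M: "M \<in> carrier_mat m n"
  shows "mat_rank (c \<cdot>\<^sub>m M) \<le> mat_rank M"
proof -
  obtain L R where L: "L \<in> carrier_mat (mat_rank M) m" and R: "R \<in> carrier_mat n (mat_rank M)"
    and eq: "(M * R) * (L * M) = M"
    using mat_rank_factorization[OF M] by metis
  have MR: "M * R \<in> carrier_mat m (mat_rank M)" and LM: "L * M \<in> carrier_mat (mat_rank M) n"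
    using L R M by auto
  have "c \<cdot>\<^sub>m M = (c \<cdot>\<^sub>m (M * R)) * (L * M)"
    using mult_smult_assoc_mat[OF MR LM, of c] eq by simp
  then show ?thesis
    using mat_rank_le_factor[of "c \<cdot>\<^sub>m (M * R)" m "mat_rank M" "L * M" n] MR LM by simp
qed

lemma mat_rank_smult:
  assumes M: "M \<in> carrier_mat m n" and c: "c \<noteq> 0"
  shows "mat_rank (c \<cdot>\<^sub>m M) = mat_rank M"
proof (rule antisym[OF mat_rank_smult_le[OF M]])
  have "M = (1 / c) \<cdot>\<^sub>m (c \<cdot>\<^sub>m M)" using c by (intro eq_matI) auto
  then show "mat_rank M \<le> mat_rank (c \<cdot>\<^sub>m M)"
    using mat_rank_smult_le[of "c \<cdot>\<^sub>m M" m n "1 / c"] M by simp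
qed

lemma unfolding_mat_scale: "unfolding_mat ns k (\<lambda>ix. c * X ix) = c \<cdot>\<^sub>m unfolding_mat ns k X"
  unfolding unfolding_mat_def by (intro eq_matI) auto

lemma tt_rank_scale: "c \<noteq> 0 \<Longrightarrow> tt_rank ns (\<lambda>ix. c * X ix) = tt_rank ns X"
  unfolding tt_rank_def unfolding_mat_scale by (simp add: mat_rank_smult[OF unfolding_mat_carrier])

text \<open>
  Right products need a full multi-index but ignore its first \<open>k\<close> entries; they are padded with zeros.
\<close>

lemma tt_tensor_factor:
  assumes len: "length ns = d" and "rs ! 0 = 1" "rs ! d = 1" and k: "k \<le> d"
  shows "\<exists>F G. \<forall>ix\<in>indices (take k ns). \<forall>jx\<in>indices (drop k ns).
    tt_tensor ns rs C (ix @ jx) = (\<Sum>b<rs ! k. F ix b * G b jx)"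
proof -
  have "tt_tensor ns rs C (ix @ jx) = (\<Sum>b<rs ! k. left_product rs C k ix b *
      right_product d rs C (d - k) (replicate k 0 @ jx) b)"
    if ix: "ix \<in> indices (take k ns)" and jx: "jx \<in> indices (drop k ns)" for ix jx
  proof -
    have l: "length ix = k" using length_in_indices[OF ix] len k by simp
    then have "ix @ jx \<in> indices ns"
      using append_in_indices[of ix "take k ns" jx "drop k ns"] ix jx len k by simp
    moreover have "left_product rs C k (ix @ jx) b = left_product rs C k ix b" for b
      using l by (intro left_product_cong) (simp add: nth_append)
    moreover have "right_product d rs C (d - k) (ix @ jx) b =
        right_product d rs C (d - k) (replicate k 0 @ jx) b" for b
      using l k by (intro right_product_cong) (auto simp: nth_append)
    ultimately show ?thesis using tt_tensor_split[OF assms(1-3) _ k, of "ix @ jx" C] by simp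
  qed
  then show ?thesis
    by (intro exI[of _ "left_product rs C k"]
      exI[of _ "\<lambda>b jx. right_product d rs C (d - k) (replicate k 0 @ jx) b"]) auto
qed

lemma unfolding_rank_le:
  assumes "\<forall>ix\<in>indices (take k ns). \<forall>jx\<in>indices (drop k ns). X (ix @ jx) = (\<Sum>b<r. F ix b * G b jx)"
  shows "mat_rank (unfolding_mat ns k X) \<le> r"
proof -
  define F' where "F' = mat (prod_list (take k ns)) r (\<lambda>(p, b). F (multi_index (take k ns) p) b)"
  define G' where "G' = mat r (prod_list (drop k ns)) (\<lambda>(b, q). G b (multi_index (drop k ns) q))"
  have "unfolding_mat ns k X = F' * G'"
  proof (rule eq_matI)
    fix p q assume "p < dim_row (F' * G')" "q < dim_col (F' * G')"
    then have "p < prod_list (take k ns)" "q < prod_list (drop k ns)" by (auto simp: F'_def G'_def)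
    then show "unfolding_mat ns k X $$ (p, q) = (F' * G') $$ (p, q)"
      using assms multi_index_in_indices
      by (auto simp: unfolding_mat_def F'_def G'_def scalar_prod_def atLeast0LessThan)
  qed (auto simp: unfolding_mat_def F'_def G'_def)
  then show ?thesis using mat_rank_le_factor[of F' "prod_list (take k ns)" r G' "prod_list (drop k ns)"] by (simp add: F'_def G'_def)
qed

lemma mat_rank_tt_tensor_le:
  assumes "length ns = d" "rs ! 0 = 1" "rs ! d = 1" "k \<le> d"
  shows "mat_rank (unfolding_mat ns k (tt_tensor ns rs C)) \<le> rs ! k"
  using tt_tensor_factor[OF assms, of C] unfolding_rank_le by blast

section \<open>Approximation by tensors of full TT rank\<close>

definition polynomial_map :: "(complex \<Rightarrow> complex) \<Rightarrow> bool" where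
  "polynomial_map f \<longleftrightarrow> (\<exists>p. \<forall>t. f t = poly p t)"

lemma polynomial_map_const: "polynomial_map (\<lambda>_. c)"
  unfolding polynomial_map_def by (rule exI[of _ "[:c:]"]) simp

lemma polynomial_map_linear: "polynomial_map (\<lambda>t. a + t * b)"
  unfolding polynomial_map_def by (rule exI[of _ "[:a, b:]"]) simp

lemma polynomial_map_add: "polynomial_map f \<Longrightarrow> polynomial_map g \<Longrightarrow> polynomial_map (\<lambda>t. f t + g t)"
  unfolding polynomial_map_def by (metis poly_add)

lemma polynomial_map_mult: "polynomial_map f \<Longrightarrow> polynomial_map g \<Longrightarrow> polynomial_map (\<lambda>t. f t * g t)"
  unfolding polynomial_map_def by (metis poly_mult)

lemma polynomial_map_sum:
  "(\<And>i. i \<in> I \<Longrightarrow> polynomial_map (f i)) \<Longrightarrow> polynomial_map (\<lambda>t. \<Sum>i\<in>I. f i t)"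
  by (induction I rule: infinite_finite_induct)
    (auto intro: polynomial_map_const polynomial_map_add)

lemma polynomial_map_prod:
  "(\<And>i. i \<in> I \<Longrightarrow> polynomial_map (f i)) \<Longrightarrow> polynomial_map (\<lambda>t. \<Prod>i\<in>I. f i t)"
  by (induction I rule: infinite_finite_induct)
    (auto intro: polynomial_map_const polynomial_map_mult)

lemma polynomial_map_det_compression:
  assumes M: "\<And>t. M t \<in> carrier_mat m n" and L: "L \<in> carrier_mat r m" and R: "R \<in> carrier_mat n r"
    and entries: "\<And>p q. p < m \<Longrightarrow> q < n \<Longrightarrow> polynomial_map (\<lambda>t. M t $$ (p, q))"
  shows "polynomial_map (\<lambda>t. det (L * M t * R))"
proof -
  have entry: "(L * M t * R) $$ (i, j) = (\<Sum>q<n. (\<Sum>p<m. L $$ (i, p) * M t $$ (p, q)) * R $$ (q, j))"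
    if "i < r" "j < r" for i j t
  proof -
    have LM: "(L * M t) $$ (i, q) = (\<Sum>p<m. L $$ (i, p) * M t $$ (p, q))" if "q < n" for q
      using L M[of t] that \<open>i < r\<close> by (auto simp: scalar_prod_def atLeast0LessThan intro!: sum.cong)
    have "(L * M t * R) $$ (i, j) = (\<Sum>q<n. (L * M t) $$ (i, q) * R $$ (q, j))"
      using mult_mat_entry[OF mult_carrier_mat[OF L M] R that] .
    then show ?thesis using LM by simp
  qed
  have "det (L * M t * R) = (\<Sum>p\<in>{p. p permutes {0..<r}}. signof p * (\<Prod>i = 0..<r. (L * M t * R) $$ (i, p i)))" for t
    using L M[of t] R by (intro det_def') auto
  also have "\<dots> t = (\<Sum>p\<in>{p. p permutes {0..<r}}. signof p * (\<Prod>i = 0..<r.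
      \<Sum>q<n. (\<Sum>l<m. L $$ (i, l) * M t $$ (l, q)) * R $$ (q, p i)))" for t
    by (intro sum.cong refl arg_cong2[of _ _ _ _ "(*)"] prod.cong) (auto simp: permutes_in_image intro!: entry)
  finally have "(\<lambda>t. det (L * M t * R)) = (\<lambda>t. \<Sum>p\<in>{p. p permutes {0..<r}}. signof p * (\<Prod>i = 0..<r.
      \<Sum>q<n. (\<Sum>l<m. L $$ (i, l) * M t $$ (l, q)) * R $$ (q, p i)))" by (rule ext)
  then show ?thesis
    by (auto intro!: polynomial_map_sum polynomial_map_mult polynomial_map_prod polynomial_map_const entries)
qed

definition core_segment :: "(nat \<Rightarrow> tensor) \<Rightarrow> (nat \<Rightarrow> tensor) \<Rightarrow> complex \<Rightarrow> nat \<Rightarrow> tensor" where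
  "core_segment C D t = (\<lambda>k l. C k l + t * (D k l - C k l))"

lemma core_segment_0 [simp]: "core_segment C D 0 = C"
  unfolding core_segment_def by simp

lemma core_segment_1 [simp]: "core_segment C D 1 = D"
  unfolding core_segment_def by simp

lemma polynomial_map_tt_segment:
  assumes "length ns = d" "rs ! 0 = 1" "rs ! d = 1"
  shows "polynomial_map (\<lambda>t. tt_tensor ns rs (core_segment C D t) ix)"
proof (cases "ix \<in> indices ns")
  case True
  have "polynomial_map (\<lambda>t. left_product rs (core_segment C D t) k ix b)" for k b
    by (induction k arbitrary: b)
      (auto simp: core_segment_def intro!: polynomial_map_const polynomial_map_sum
        polynomial_map_mult polynomial_map_linear)
  then show ?thesis using tt_tensor_left_product[OF assms True] by simp
next
  case False
  then show ?thesis unfolding tt_tensor_def by (simp add: polynomial_map_const)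
qed

lemma eventually_polynomial_nonzero:
  assumes "polynomial_map f" and "f s \<noteq> 0"
  shows "eventually (\<lambda>t. f t \<noteq> 0) (at z)"
proof -
  obtain p where p: "\<And>t. f t = poly p t" using assms(1) unfolding polynomial_map_def by blast
  then have "p \<noteq> 0" using assms(2) by auto
  then have "finite {x. poly p x = 0}" by (rule poly_roots_finite)
  then have "eventually (\<lambda>t. \<forall>x\<in>{x. poly p x = 0}. t \<noteq> x) (at z)"
    by (intro eventually_ball_finite) (auto intro: eventually_neq_at_within)
  then show ?thesis by (rule eventually_mono) (auto simp: p)
qed

text \<open>
  Along the segment the ranks never exceed \<open>rs\<close>. They are at least \<open>rs\<close> wherever the compressions
  that witness the ranks at the end point \<open>D\<close> have nonzero determinant, which fails only at finitely
  many parameters.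
\<close>

lemma eventually_segment_tt_rank:
  assumes len: "length ns = d" and d: "1 \<le> d" and lr: "length rs = d + 1"
    and r: "rs ! 0 = 1" "rs ! d = 1" and D: "tt_rank ns (tt_tensor ns rs D) = rs"
  shows "eventually (\<lambda>t. tt_rank ns (tt_tensor ns rs (core_segment C D t)) = rs) (at z)"
proof -
  define X where "X = (\<lambda>t. tt_tensor ns rs (core_segment C D t))"
  have X: "polynomial_map (\<lambda>t. X t ix)" for ix
    unfolding X_def by (rule polynomial_map_tt_segment[OF len r])
  have "eventually (\<lambda>t. mat_rank (unfolding_mat ns k (X t)) = rs ! k) (at z)" if k: "k \<in> {1..<d}" for k
  proof -
    have "mat_rank (unfolding_mat ns k (X 1)) = rs ! k"
      using tt_rank_nth[OF D] k len by (simp add: X_def)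
    then obtain L R where L: "L \<in> carrier_mat (rs ! k) (prod_list (take k ns))"
      and R: "R \<in> carrier_mat (prod_list (drop k ns)) (rs ! k)"
      and one: "L * unfolding_mat ns k (X 1) * R = 1\<^sub>m (rs ! k)"
      using mat_rank_factorization[OF unfolding_mat_carrier] by metis
    have "polynomial_map (\<lambda>t. det (L * unfolding_mat ns k (X t) * R))"
      by (rule polynomial_map_det_compression[OF unfolding_mat_carrier L R])
        (simp add: unfolding_mat_def X)
    moreover have "det (L * unfolding_mat ns k (X 1) * R) \<noteq> 0" using one by simp
    ultimately have "eventually (\<lambda>t. det (L * unfolding_mat ns k (X t) * R) \<noteq> 0) (at z)"
      by (rule eventually_polynomial_nonzero)
    then show ?thesis
    proof (rule eventually_mono)
      fix t assume "det (L * unfolding_mat ns k (X t) * R) \<noteq> 0"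
      then have "rs ! k \<le> mat_rank (unfolding_mat ns k (X t))"
        by (rule mat_rank_ge_nonzero_det[OF unfolding_mat_carrier L R])
      then show "mat_rank (unfolding_mat ns k (X t)) = rs ! k"
        using mat_rank_tt_tensor_le[OF len r, of k "core_segment C D t"] k unfolding X_def by simp
    qed
  qed
  then have "eventually (\<lambda>t. \<forall>k\<in>{1..<d}. mat_rank (unfolding_mat ns k (X t)) = rs ! k) (at z)"
    by (intro eventually_ball_finite) auto
  then show ?thesis
    by (rule eventually_mono) (intro tt_rank_eqI[OF len d lr r], auto simp: X_def)
qed

lemma fnorm_scale: "fnorm ns (\<lambda>ix. c * X ix) = cmod c * fnorm ns X"
  unfolding fnorm_def by (simp add: norm_mult power_mult_distrib real_sqrt_mult flip: sum_distrib_left)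

lemma tendsto_fnorm:
  assumes "\<And>ix. ((\<lambda>t. X t ix) \<longlongrightarrow> Y ix) F"
  shows "((\<lambda>t. fnorm ns (X t)) \<longlongrightarrow> fnorm ns Y) F"
  unfolding fnorm_def by (intro tendsto_intros assms)

text \<open>
  The cores \<open>C\<close> may give smaller ranks than \<open>rs\<close>, so the normalized tensor need not be a competitor for
  \<open>P\<close>. It is a limit of competitors: the points near 0 on the segment from \<open>C\<close> to cores of \<open>P\<close>,
  normalized.
\<close>

lemma best_approximation_le_normalized_tt:
  assumes len: "length ns = d" and d: "1 \<le> d" and lr: "length rs = d + 1"
    and r: "rs ! 0 = 1" "rs ! d = 1"
    and best: "best_approximation ns (normalized_tt ns rs) A P"
    and nz: "fnorm ns (tt_tensor ns rs C) \<noteq> 0"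
  shows "fnorm ns (P - A) \<le>
    fnorm ns ((\<lambda>ix. tt_tensor ns rs C ix / of_real (fnorm ns (tt_tensor ns rs C))) - A)"
proof -
  define nrm :: "tensor \<Rightarrow> tensor" where "nrm = (\<lambda>X ix. X ix / of_real (fnorm ns X))"
  have P: "P \<in> tensors ns" "tt_rank ns P = rs"
    and min: "\<And>X. X \<in> normalized_tt ns rs \<Longrightarrow> fnorm ns (P - A) \<le> fnorm ns (X - A)"
    using best unfolding best_approximation_def normalized_tt_def by auto
  obtain D where D: "P = tt_tensor ns rs D"
    using exact_tt_decomposition[OF len d r P] by blast
  define X where "X = (\<lambda>t. tt_tensor ns rs (core_segment C D t))"
  have lim: "((\<lambda>t. X t ix) \<longlongrightarrow> X 0 ix) (at 0)" for ix
  proof -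
    obtain p where "\<And>t. X t ix = poly p t"
      using polynomial_map_tt_segment[OF len r, of C D ix] unfolding polynomial_map_def X_def by blast
    then show ?thesis using poly_isCont[where p = p and x = 0] unfolding isCont_def by simp
  qed
  have lim_norm: "((\<lambda>t. fnorm ns (X t)) \<longlongrightarrow> fnorm ns (X 0)) (at 0)"
    by (rule tendsto_fnorm) (rule lim)
  have nz0: "fnorm ns (X 0) \<noteq> 0" using nz by (simp add: X_def)
  have "((\<lambda>t. fnorm ns (nrm (X t) - A)) \<longlongrightarrow> fnorm ns (nrm (X 0) - A)) (at 0)"
    unfolding nrm_def fun_diff_def using nz0 by (intro tendsto_fnorm tendsto_intros lim lim_norm) auto
  moreover have "eventually (\<lambda>t. fnorm ns (P - A) \<le> fnorm ns (nrm (X t) - A)) (at 0)"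
  proof -
    have "eventually (\<lambda>t. fnorm ns (X t) \<noteq> 0) (at 0)"
      using tendsto_imp_eventually_ne[OF lim_norm nz0] .
    moreover have "eventually (\<lambda>t. tt_rank ns (X t) = rs) (at 0)"
      unfolding X_def using P(2) by (intro eventually_segment_tt_rank[OF len d lr r]) (simp add: D)
    ultimately show ?thesis
    proof eventually_elim
      case (elim t)
      have nrm: "nrm (X t) = (\<lambda>ix. (1 / of_real (fnorm ns (X t))) * X t ix)"
        unfolding nrm_def by simp
      have "tt_rank ns (nrm (X t)) = rs" unfolding nrm using elim by (subst tt_rank_scale) auto
      moreover have "fnorm ns (nrm (X t)) = 1"
        unfolding nrm fnorm_scale using elim by (simp add: norm_divide) (simp add: fnorm_def sum_nonneg)
      moreover have "nrm (X t) \<in> tensors ns"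
        using tt_tensor_in_tensors unfolding tensors_def nrm_def X_def by auto
      ultimately show ?case by (intro min) (simp add: normalized_tt_def)
    qed
  qed
  ultimately have "fnorm ns (P - A) \<le> fnorm ns (nrm (X 0) - A)"
    by (rule tendsto_lowerbound) simp
  then show ?thesis by (simp add: nrm_def X_def)
qed

lemma fnorm_diff_triangle: "fnorm ns (X - Z) \<le> fnorm ns (X - Y) + fnorm ns (Y - Z)"
proof -
  have "fnorm ns (X - Z) \<le> L2_set (\<lambda>ix. cmod (X ix - Y ix) + cmod (Y ix - Z ix)) (indices ns)"
    unfolding fnorm_def L2_set_def[symmetric]
    by (intro L2_set_mono) (auto intro: order.trans[OF _ norm_triangle_ineq])
  also have "\<dots> \<le> L2_set (\<lambda>ix. cmod (X ix - Y ix)) (indices ns) + L2_set (\<lambda>ix. cmod (Y ix - Z ix)) (indices ns)"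
    by (rule L2_set_triangle_ineq)
  also have "\<dots> = fnorm ns (X - Y) + fnorm ns (Y - Z)"
    unfolding fnorm_def L2_set_def by simp
  finally show ?thesis .
qed

lemma fnorm_minus_commute: "fnorm ns (X - Y) = fnorm ns (Y - X)"
  unfolding fnorm_def by (simp add: norm_minus_commute)

lemma fnorm_nonneg: "0 \<le> fnorm ns X"
  unfolding fnorm_def by (simp add: sum_nonneg)

lemma fnorm_diff_abs: "\<bar>fnorm ns X - fnorm ns Y\<bar> \<le> fnorm ns (X - Y)"
  using fnorm_diff_triangle[of ns X "\<lambda>_. 0" Y] fnorm_diff_triangle[of ns Y "\<lambda>_. 0" X]
    fnorm_minus_commute[of ns Y X]
  by (simp add: fnorm_def)

section \<open>The two inequalities\<close>

theorem proposition3p2: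
  fixes d :: nat and ns rs :: "nat list" and A P Q :: tensor
  assumes "d \<ge> 2"
    and "length ns = d" and "\<forall>n \<in> set ns. n \<ge> 1"
    and "A \<in> tensors ns"
    and "length rs = d + 1" and "rs ! 0 = 1" and "rs ! d = 1"
    and "normalized_tt ns rs \<noteq> {}"
    and "best_approximation ns (normalized_tt ns rs) A P"
    and "nttsvd_output ns rs A Q"
  shows "fnorm ns (P - A) \<le> fnorm ns (Q - A)
    \<and> fnorm ns (Q - A) \<le> (2 * sqrt (real (d - 1)) + 1) * fnorm ns (P - A)"
proof -
  have d: "1 \<le> d" using assms(1) by simp
  have PN: "P \<in> tensors ns" "tt_rank ns P = rs" "fnorm ns P = 1"
    using assms(9) unfolding best_approximation_def normalized_tt_def by auto
  obtain Y where "ttsvd_output ns rs A Y" and proj: "sphere_projection ns Y Q"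
    using assms(10) unfolding nttsvd_output_def by blast
  then obtain T C where TC: "T 0 = unfolding_mat ns 0 A"
      "\<forall>k \<in> {1..<length ns}. \<exists>U S V.
           truncated_svd (rs ! k)
             (reshape (rs ! (k - 1) * ns ! (k - 1)) (prod_list (drop k ns)) (T (k - 1))) U S V \<and>
           C k = mat_to_core (rs ! (k - 1)) (ns ! (k - 1)) (rs ! k) U \<and>
           T k = S * mat_adjoint V"
      "C (length ns) =
          (let r = rs ! (length ns - 1); n = ns ! (length ns - 1)
           in mat_to_core r n 1 (reshape (r * n) 1 (T (length ns - 1))))"
    and Y: "Y = tt_tensor ns rs C"
    unfolding ttsvd_output_def by blast
  interpret ttsvd_run d ns rs A T C
    by unfold_locales (use assms d TC in \<open>auto simp: Let_def\<close>)
  have factors: "\<exists>F G. \<forall>ix\<in>indices (take k ns). \<forall>jx\<in>indices (drop k ns).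
      P (ix @ jx) = (\<Sum>b<rs ! k. F ix b * G b jx)" if k: "1 \<le> k" "k < d" for k
  proof -
    obtain F L where "\<forall>ix\<in>indices (take k ns). \<forall>jx\<in>indices (drop k ns).
        P (ix @ jx) = (\<Sum>b<rs ! k. F ix b * (\<Sum>y\<in>indices (take k ns). L b y * P (y @ jx)))"
      using unfolding_rank_factorization[OF tt_rank_nth[OF PN(2) k(1)]] k(2) assms(2) by blast
    then show ?thesis
      by (intro exI[of _ F] exI[of _ "\<lambda>b jx. \<Sum>y\<in>indices (take k ns). L b y * P (y @ jx)"])
  qed
  have YA: "fnorm ns (Y - A) \<le> sqrt (real (d - 1)) * fnorm ns (P - A)"
    unfolding Y by (rule ttsvd_quasi_optimal[OF factors])
  \<comment> \<open>A tensor with an unfolding of rank 0 vanishes, but \<open>P\<close> has norm 1.\<close>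
  have rank_pos: "1 \<le> rs ! k" if k: "1 \<le> k" "k < d" for k
  proof (rule ccontr)
    assume "\<not> 1 \<le> rs ! k"
    then have "rs ! k = 0" by simp
    then have "P (ix @ jx) = 0" if "ix \<in> indices (take k ns)" "jx \<in> indices (drop k ns)" for ix jx
      using factors[OF k] that by auto
    then have "(\<Sum>ix\<in>indices ns. (cmod (P ix))\<^sup>2) = 0"
      by (subst sum_indices_take_drop[of _ _ k]) simp
    then show False using PN(3) by (simp add: fnorm_def)
  qed
  show ?thesis
  proof (cases "Y = (\<lambda>_. 0)")
    case True
    \<comment> \<open>All unit tensors, among them \<open>P\<close> and the arbitrary \<open>Q\<close>, have distance 1 from 0.\<close>
    then have A0: "A = (\<lambda>_. 0)" using ttsvd_zero_imp_zero[OF rank_pos] Y by simp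
    have "fnorm ns Q = 1" using proj True unfolding sphere_projection_def unit_sphere_def by simp
    moreover have "X - A = X" for X :: tensor unfolding A0 by auto
    ultimately show ?thesis using PN(3) by simp
  next
    case False
    have nz: "fnorm ns Y \<noteq> 0"
    proof
      assume "fnorm ns Y = 0"
      then have "sqnorm_on (indices ns) Y = 0" by (simp add: sqnorm_on_indices)
      then have "Y = (\<lambda>_. 0)"
        using tt_tensor_in_tensors[of ns rs C] unfolding Y by (auto simp: sqnorm_on_zero_iff tensors_def)
      then show False using False by simp
    qed
    have Q: "Q = (\<lambda>ix. Y ix / of_real (fnorm ns Y))"
      using proj False unfolding sphere_projection_def by simp
    have "fnorm ns (P - A) \<le> fnorm ns (Q - A)"
      unfolding Q Y
      using best_approximation_le_normalized_tt[OF assms(2) d assms(5-7,9), of C] nz Y by simp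
    moreover have "fnorm ns (Q - A) \<le> (2 * sqrt (real (d - 1)) + 1) * fnorm ns (P - A)"
    proof -
      define s where "s = fnorm ns Y"
      have s: "s > 0" using nz fnorm_nonneg[of ns Y] unfolding s_def by simp
      \<comment> \<open>\<open>Q\<close> is as close to \<open>Y\<close> as their norms allow, in particular at least as close as the unit tensor \<open>P\<close>.\<close>
      have "Q - Y = (\<lambda>ix. of_real (1 / s - 1) * Y ix)"
        unfolding Q s_def[symmetric] by (auto simp: algebra_simps)
      then have "fnorm ns (Q - Y) = \<bar>1 / s - 1\<bar> * s"
        unfolding s_def by (simp only: fnorm_scale norm_of_real)
      also have "\<dots> = \<bar>fnorm ns Y - fnorm ns P\<bar>"
        using s unfolding PN(3) s_def[symmetric] by (simp add: abs_if field_simps)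
      also have "\<dots> \<le> fnorm ns (Y - P)" by (rule fnorm_diff_abs)
      also have "\<dots> \<le> fnorm ns (Y - A) + fnorm ns (P - A)"
        using fnorm_diff_triangle[of ns Y P A] by (simp add: fnorm_minus_commute[of ns A P])
      finally show ?thesis
        using fnorm_diff_triangle[of ns Q A Y] YA by (simp add: algebra_simps)
    qed
    ultimately show ?thesis ..
  qed
qed

end
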